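(* Let $\mathcal{A}$ be a finite alphabet and let $X \subset \mathcal{A}^{\mathbb{Z}}$ be a nonempty one-dimensional transitive SFT. Then $X$ is the generic limit set of some cellular automaton if and only if $X$ is mixing.
   Context: $\mathcal{A}^{\mathbb{Z}}$ carries the product of the discrete topologies; $\sigma$ is the left shift, $\sigma(x)_i = x_{i+1}$. A subshift is a closed $\sigma$-invariant subset of $\mathcal{A}^{\mathbb{Z}}$; it is a subshift of finite type (SFT) if it is the set of configurations in which no word of some finite set $F \subset \mathcal{A}^*$ occurs. The language $\mathcal{L}(X)$ is the set of finite words occurring as subwords of configurations in $X$. A subshift is transitive if for all $u,v \in \mathcal{L}(X)$ there is $w \in \mathcal{L}(X)$ with $uwv \in \mathcal{L}(X)$, and mixing if moreover for every large enough $n$ (depending on $u,v$) such a $w$ exists with length $n$. A (one-dimensional) cellular automaton over a finite alphabet $\mathcal{B}$ is a map $f : \mathcal{B}^{\mathbb{Z}} \to \mathcal{B}^{\mathbb{Z}}$ of the form $f(x)_i = F(x_{i-r},\dots,x_{i+r})$ for some $r \in \mathbb{N}$ and $F : \mathcal{B}^{2r+1} \to \mathcal{B}$. A set is meager if it is a countable union of sets whose closures have empty interior, comeager if its complement is meager. For $x \in \mathcal{B}^{\mathbb{Z}}$ let $\omega(x) = \bigcap_{N} \overline{\{f^n(x) \mid n \ge N\}}$, and for closed $K$ let $\mathcal{D}(K) = \{x \mid \omega(x) \subset K\}$; $K$ is a generic attractor if $\mathcal{D}(K)$ is comeager. The generic limit set $\widetilde\omega(f)$ is the intersection of all generic attractors,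 which is the smallest generic attractor. "$X$ is the generic limit set of some cellular automaton" means that $X = \widetilde\omega(f)$ for some cellular automaton $f$ over some finite alphabet $\mathcal{B} \supset \mathcal{A}$, with $X$ regarded as a subset of $\mathcal{B}^{\mathbb{Z}}$. *)

theory Defs
  imports "HOL-Analysis.Analysis"
begin

text \<open>
  An alphabet is a set of symbols, so that an inclusion of alphabets \<open>A \<subseteq> B\<close> makes the
  configurations over \<open>A\<close> literally configurations over \<open>B\<close>.
  To quantify over all finite alphabets extending a given one, the type of symbols must be infinite.
\<close>

type_synonym 'a config = "int \<Rightarrow> 'a"

definition config_top :: "'a set \<Rightarrow> 'a config topology" where
  "config_top A = product_topology (\<lambda>_. discrete_topology A) UNIV"

abbreviation configs :: "'a set \<Rightarrow> 'a config set" where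
  "configs A \<equiv> topspace (config_top A)"

lemma configs_iff: "x \<in> configs A \<longleftrightarrow> (\<forall>i. x i \<in> A)"
  by (auto simp: config_top_def PiE_def Pi_def)

definition shift :: "'a config \<Rightarrow> 'a config" where
  "shift x = (\<lambda>i. x (i + 1))"

definition occurs_in :: "'a list \<Rightarrow> 'a config \<Rightarrow> bool" where
  "occurs_in w x \<longleftrightarrow> (\<exists>i. \<forall>k<length w. x (i + int k) = w ! k)"

definition subshift :: "'a set \<Rightarrow> 'a config set \<Rightarrow> bool" where
  "subshift A X \<longleftrightarrow> closedin (config_top A) X \<and> shift ` X = X"

definition SFT :: "'a set \<Rightarrow> 'a config set \<Rightarrow> bool" where
  "SFT A X \<longleftrightarrow> subshift A X \<and>
    (\<exists>F. finite F \<and> F \<subseteq> lists A \<and> X = {x \<in> configs A. \<forall>w\<in>F. \<not> occurs_in w x})"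

definition lang :: "'a config set \<Rightarrow> 'a list set" where
  "lang X = {w. \<exists>x\<in>X. occurs_in w x}"

definition transitive_shift :: "'a config set \<Rightarrow> bool" where
  "transitive_shift X \<longleftrightarrow> (\<forall>u\<in>lang X. \<forall>v\<in>lang X. \<exists>w\<in>lang X. u @ w @ v \<in> lang X)"

definition mixing_shift :: "'a config set \<Rightarrow> bool" where
  "mixing_shift X \<longleftrightarrow> transitive_shift X \<and>
    (\<forall>u\<in>lang X. \<forall>v\<in>lang X. \<exists>N. \<forall>n\<ge>N. \<exists>w\<in>lang X. length w = n \<and> u @ w @ v \<in> lang X)"

text \<open>
  The local rule takes the word read in the window \<open>[i - r, i + r]\<close>.  Only the restriction of \<open>f\<close> to
  the configurations over \<open>B\<close> matters.
\<close>

definition cellular_automaton :: "'a set \<Rightarrow> ('a config \<Rightarrow> 'a config) \<Rightarrow> bool" where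
  "cellular_automaton B f \<longleftrightarrow>
    (\<exists>(r::nat) F. (\<forall>w\<in>lists B. length w = 2 * r + 1 \<longrightarrow> F w \<in> B) \<and>
      (\<forall>x\<in>configs B. \<forall>i. f x i = F (map (\<lambda>j. x (i + j)) [- int r..int r])))"

definition meager_in :: "'b topology \<Rightarrow> 'b set \<Rightarrow> bool" where
  "meager_in T M \<longleftrightarrow>
    (\<exists>\<U>. countable \<U> \<and> (\<forall>U\<in>\<U>. U \<subseteq> topspace T \<and> T interior_of (T closure_of U) = {}) \<and> M = \<Union>\<U>)"

definition comeager_in :: "'b topology \<Rightarrow> 'b set \<Rightarrow> bool" where
  "comeager_in T M \<longleftrightarrow> M \<subseteq> topspace T \<and> meager_in T (topspace T - M)"

definition omega_limit :: "'a set \<Rightarrow> ('a config \<Rightarrow> 'a config) \<Rightarrow> 'a config \<Rightarrow> 'a config set" where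
  "omega_limit B f x = (\<Inter>N. config_top B closure_of {(f ^^ n) x | n. n \<ge> N})"

definition attraction_realm :: "'a set \<Rightarrow> ('a config \<Rightarrow> 'a config) \<Rightarrow> 'a config set \<Rightarrow> 'a config set" where
  "attraction_realm B f K = {x \<in> configs B. omega_limit B f x \<subseteq> K}"

definition generic_attractor :: "'a set \<Rightarrow> ('a config \<Rightarrow> 'a config) \<Rightarrow> 'a config set \<Rightarrow> bool" where
  "generic_attractor B f K \<longleftrightarrow>
    closedin (config_top B) K \<and> comeager_in (config_top B) (attraction_realm B f K)"

definition generic_limit_set :: "'a set \<Rightarrow> ('a config \<Rightarrow> 'a config) \<Rightarrow> 'a config set" where
  "generic_limit_set B f = \<Inter> {K. generic_attractor B f K}"

end

theory Submission
  imports Defs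
begin

text \<open>
  A subshift of finite type \<open>X\<close> consists of the configurations all of whose windows of some fixed
  length \<open>m\<close> occur in \<open>X\<close> (lemma \<open>SFT_window\<close>).  Hence two points of \<open>X\<close> that share a window can be
  glued along it, and the relation \<open>reach u d v\<close>, that some point of \<open>X\<close> shows the window \<open>u\<close> at the
  origin and \<open>v\<close> at position \<open>d\<close>, composes like paths in a graph.  Transitivity makes this graph
  strongly connected, and \<open>X\<close> is mixing exactly if its period is one.

  A generic limit set is mixing.  Suppose that \<open>X\<close> is the generic limit set of \<open>f\<close> and has period \<open>p\<close>.
  Every window has a phase modulo \<open>p\<close>, which increases by one along a shift by one cell.  Because \<open>f\<close>
  preserves \<open>X\<close> and \<open>X\<close> is transitive, \<open>f\<close> adds one and the same constant to all phases
  (\<open>phase_drift\<close>).  By Baire's theorem some cylinder forces the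
  windows around the origin to stay in the language of \<open>X\<close> from a time \<open>N\<close> on (\<open>settling_cylinder\<close>); if
  the cylinder also determines the window at time \<open>N\<close>, it determines the phase at the origin at all later
  times.  Two copies of the central pattern of this cylinder at distance \<open>j\<close> therefore carry the same
  phase at the same time.  But a generic configuration that contains both copies eventually shows a
  word of \<open>X\<close> on the whole interval that joins them, so that the phases differ by \<open>j\<close>.  Thus \<open>p\<close> divides
  every large \<open>j\<close>, and \<open>p = 1\<close>.

  A mixing \<open>X\<close> is a generic limit set.  By mixing there is \<open>N\<close> such that any two windows occur at any
  given distance of at least \<open>N\<close> in a point of \<open>X\<close>.  Call a position a core of a configuration if all windows
  starting within distance \<open>N\<close> of it are windows of \<open>X\<close>.  The point of this margin is that two
  consecutive cores are either adjacent or at least \<open>N\<close> apart (\<open>gap_wide\<close>), so that a gap can always be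
  bridged without touching the cores.  The automaton \<open>repair\<close>, over the same alphabet, keeps the
  cores, fills a short gap completely by a bridge, and extends a core bordering on a long gap by
  valid symbols.  Cores are never lost, and every gap between two cores closes in finite time
  (\<open>cores_fill_up\<close>).  A generic configuration has cores arbitrarily far out on both sides, so it
  converges to a point of \<open>X\<close>; and every word of \<open>X\<close> with enough context around it is left untouched,
  so that no generic attractor can omit a point of \<open>X\<close>.
\<close>

section \<open>Configuration spaces as product spaces\<close>

lemma compact_space_config_top: "finite B \<Longrightarrow> compact_space (config_top B)"
  by (simp add: config_top_def compact_space_product_topology compact_space_discrete_topology)

lemma Hausdorff_space_config_top: "Hausdorff_space (config_top B)"
  by (simp add: config_top_def Hausdorff_space_product_topology Hausdorff_space_discrete_topology)

text \<open>
  The central cylinders \<open>{y. \<forall>i. \<bar>i\<bar> \<le> R \<longrightarrow> y i = x i}\<close> form a neighbourhood basis at \<open>x\<close>, since a basic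
  open set of the product constrains only finitely many coordinates.  This reduces all later
  topological arguments to agreement on intervals.
\<close>

lemma openin_config_top_iff:
  "openin (config_top B) U \<longleftrightarrow> U \<subseteq> configs B \<and>
     (\<forall>x\<in>U. \<exists>R. \<forall>y\<in>configs B. (\<forall>i. \<bar>i\<bar> \<le> R \<longrightarrow> y i = x i) \<longrightarrow> y \<in> U)"
proof (intro iffI conjI ballI)
  assume U: "openin (config_top B) U"
  then show "U \<subseteq> configs B" by (rule openin_subset)
  fix x assume "x \<in> U"
  then obtain V where V: "finite {i. V i \<noteq> topspace (discrete_topology B)}" "x \<in> Pi\<^sub>E UNIV V"
      "Pi\<^sub>E UNIV V \<subseteq> U"
    using U by (auto simp: config_top_def openin_product_topology_alt)
  define S where "S = {i. V i \<noteq> topspace (discrete_topology B)}"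
  define R where "R = Max (insert 0 (abs ` S))"
  have R: "\<bar>i\<bar> \<le> R" if "i \<in> S" for i
    unfolding R_def using V(1) that by (intro Max_ge) (auto simp: S_def)
  have "y \<in> U" if y: "y \<in> configs B" "\<forall>i. \<bar>i\<bar> \<le> R \<longrightarrow> y i = x i" for y
  proof -
    have "y i \<in> V i" for i
    proof (cases "i \<in> S")
      case True
      then show ?thesis using R y(2) V(2) by (auto simp: PiE_iff)
    next
      case False
      then show ?thesis using y(1) by (auto simp: S_def configs_iff)
    qed
    then show ?thesis using V(3) by auto
  qed
  then show "\<exists>R. \<forall>y\<in>configs B. (\<forall>i. \<bar>i\<bar> \<le> R \<longrightarrow> y i = x i) \<longrightarrow> y \<in> U" by blast
next
  assume A: "U \<subseteq> configs B \<and>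
     (\<forall>x\<in>U. \<exists>R. \<forall>y\<in>configs B. (\<forall>i. \<bar>i\<bar> \<le> R \<longrightarrow> y i = x i) \<longrightarrow> y \<in> U)"
  show "openin (config_top B) U"
    unfolding config_top_def openin_product_topology_alt
  proof (intro ballI)
    fix x assume x: "x \<in> U"
    then obtain R where R: "\<And>y. y\<in>configs B \<Longrightarrow> (\<forall>i. \<bar>i\<bar> \<le> R \<longrightarrow> y i = x i) \<Longrightarrow> y \<in> U" 
      using A by blast
    have xB: "x i \<in> B" for i using A x by (auto simp: configs_iff)
    let ?V = "\<lambda>i. if \<bar>i\<bar> \<le> R then {x i} else B"
    have "{i \<in> UNIV. ?V i \<noteq> topspace (discrete_topology B)} \<subseteq> {-R..R}"
      by (auto split: if_splits)
    then have "finite {i \<in> UNIV. ?V i \<noteq> topspace (discrete_topology B)}"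
      by (rule finite_subset) simp
    moreover have "\<forall>i\<in>UNIV. openin (discrete_topology B) (?V i)" using xB by auto
    moreover have "x \<in> Pi\<^sub>E UNIV ?V" using xB by auto
    moreover have "Pi\<^sub>E UNIV ?V \<subseteq> U"
    proof
      fix y assume "y \<in> Pi\<^sub>E UNIV ?V"
      then have y: "y i \<in> ?V i" for i by (auto simp only: PiE_iff)
      show "y \<in> U"
      proof (rule R)
        show "y \<in> configs B" using y xB by (metis configs_iff singletonD)
        show "\<forall>i. \<bar>i\<bar> \<le> R \<longrightarrow> y i = x i" using y by (metis singletonD)
      qed
    qed
    ultimately show "\<exists>Ua. finite {i \<in> UNIV. Ua i \<noteq> topspace (discrete_topology B)} \<and>
        (\<forall>i\<in>UNIV. openin (discrete_topology B) (Ua i)) \<and> x \<in> Pi\<^sub>E UNIV Ua \<and> Pi\<^sub>E UNIV Ua \<subseteq> U"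
      by (intro exI[of _ ?V]) simp
  qed
qed

lemma closedin_config_top_iff:
  "closedin (config_top B) K \<longleftrightarrow> K \<subseteq> configs B \<and>
     (\<forall>x\<in>configs B. (\<forall>R. \<exists>y\<in>K. \<forall>i. \<bar>i\<bar> \<le> R \<longrightarrow> y i = x i) \<longrightarrow> x \<in> K)"
proof -
  have "openin (config_top B) (configs B - K) \<longleftrightarrow>
     (\<forall>x\<in>configs B. (\<forall>R. \<exists>y\<in>K \<inter> configs B. \<forall>i. \<bar>i\<bar> \<le> R \<longrightarrow> y i = x i) \<longrightarrow> x \<in> K)"
    unfolding openin_config_top_iff by blast
  then show ?thesis
    unfolding closedin_def by (metis inf.absorb1)
qed

lemma in_closure_of_config_top:
  "x \<in> config_top B closure_of S \<longleftrightarrow>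
     x \<in> configs B \<and> (\<forall>R. \<exists>y\<in>S \<inter> configs B. \<forall>i. \<bar>i\<bar> \<le> R \<longrightarrow> y i = x i)" (is "_ = (_ \<and> (\<forall>R. ?Q R))")
proof (intro iffI conjI allI)
  assume x: "x \<in> config_top B closure_of S"
  then show xB: "x \<in> configs B" by (simp add: in_closure_of)
  fix R
  have "openin (config_top B) {y \<in> configs B. \<forall>i. \<bar>i\<bar> \<le> R \<longrightarrow> y i = x i}"
    unfolding openin_config_top_iff by (auto intro!: exI[of _ R])
  moreover have "x \<in> {y \<in> configs B. \<forall>i. \<bar>i\<bar> \<le> R \<longrightarrow> y i = x i}" using xB by simp
  ultimately have "\<exists>y. y \<in> S \<and> y \<in> {y \<in> configs B. \<forall>i. \<bar>i\<bar> \<le> R \<longrightarrow> y i = x i}"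
    using x by (meson in_closure_of)
  then show "?Q R" by blast
next
  assume A: "x \<in> configs B \<and> (\<forall>R. ?Q R)"
  show "x \<in> config_top B closure_of S"
    unfolding in_closure_of
  proof (intro conjI allI impI)
    fix T assume "x \<in> T \<and> openin (config_top B) T"
    then show "\<exists>y. y \<in> S \<and> y \<in> T" using A unfolding openin_config_top_iff by (metis IntE)
  qed (use A in auto)
qed

lemma clopen_of_local:
  assumes P: "\<And>x y. x \<in> configs B \<Longrightarrow> y \<in> configs B \<Longrightarrow> (\<forall>i. \<bar>i\<bar> \<le> R \<longrightarrow> y i = x i) \<Longrightarrow> P x = P y"
  shows "openin (config_top B) {x \<in> configs B. P x}" "closedin (config_top B) {x \<in> configs B. P x}"
proof -
  have 1: "openin (config_top B) {x \<in> configs B. Q x}"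
    if Q: "\<And>x y. x \<in> configs B \<Longrightarrow> y \<in> configs B \<Longrightarrow> (\<forall>i. \<bar>i\<bar> \<le> R \<longrightarrow> y i = x i) \<Longrightarrow> Q x = Q y" for Q
    unfolding openin_config_top_iff
  proof (intro conjI ballI exI impI)
    fix x y assume "x \<in> {x \<in> configs B. Q x}" "y \<in> configs B" "\<forall>i. \<bar>i\<bar> \<le> R \<longrightarrow> y i = x i"
    then show "y \<in> {x \<in> configs B. Q x}" using Q[of x y] by simp
  qed (rule Collect_restrict)
  show "openin (config_top B) {x \<in> configs B. P x}" by (rule 1, rule P)
  have "openin (config_top B) {x \<in> configs B. \<not> P x}" by (rule 1) (simp only: P)
  moreover have "configs B - {x \<in> configs B. P x} = {x \<in> configs B. \<not> P x}" by auto
  ultimately show "closedin (config_top B) {x \<in> configs B. P x}" unfolding closedin_def by auto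
qed

section \<open>Comeager sets\<close>

lemma comeager_mono:
  assumes "comeager_in T M" "M \<subseteq> N" "N \<subseteq> topspace T"
  shows "comeager_in T N"
proof -
  obtain \<U> where U: "countable \<U>" "\<forall>U\<in>\<U>. U \<subseteq> topspace T \<and> T interior_of (T closure_of U) = {}"
     "topspace T - M = \<Union>\<U>"
    using assms(1) unfolding comeager_in_def meager_in_def by (elim conjE exE) (rule that)
  let ?V = "(\<lambda>U. U \<inter> (topspace T - N)) ` \<U>"
  have "countable ?V" using U(1) by simp
  moreover have "\<forall>V\<in>?V. V \<subseteq> topspace T \<and> T interior_of (T closure_of V) = {}"
  proof
    fix V assume "V \<in> ?V"
    then obtain U where U': "U \<in> \<U>" "V \<subseteq> U" "V \<subseteq> topspace T" by blast
    have "T interior_of (T closure_of V) \<subseteq> T interior_of (T closure_of U)"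
      by (intro interior_of_mono closure_of_mono U')
    then show "V \<subseteq> topspace T \<and> T interior_of (T closure_of V) = {}" using U' U(2) by auto
  qed
  moreover have "topspace T - N = \<Union>?V" using U(3) assms(2) by auto
  ultimately show ?thesis using assms(3) unfolding comeager_in_def meager_in_def
    by (intro conjI exI[of _ ?V])
qed

lemma comeager_Inter:
  assumes "countable I" "I \<noteq> {}" "\<And>i. i \<in> I \<Longrightarrow> comeager_in T (M i)"
  shows "comeager_in T (\<Inter>i\<in>I. M i)"
proof -
  define Q where "Q i \<U> \<longleftrightarrow> countable \<U> \<and>
      (\<forall>U\<in>\<U>. U \<subseteq> topspace T \<and> T interior_of (T closure_of U) = {}) \<and>
      topspace T - M i = \<Union>\<U>" for i \<U>
  have "\<forall>i\<in>I. \<exists>\<U>. Q i \<U>"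
    using assms(3) unfolding comeager_in_def meager_in_def Q_def by simp
  then obtain \<U> where Q: "\<And>i. i \<in> I \<Longrightarrow> Q i (\<U> i)"
    by (auto dest!: bchoice)
  have U: "countable (\<U> i)" "\<And>U. U \<in> \<U> i \<Longrightarrow> U \<subseteq> topspace T"
      "\<And>U. U \<in> \<U> i \<Longrightarrow> T interior_of (T closure_of U) = {}"
      "topspace T - M i = \<Union>(\<U> i)" if "i \<in> I" for i
    using Q[OF that] unfolding Q_def by simp_all
  have "topspace T - (\<Inter>i\<in>I. M i) = (\<Union>i\<in>I. topspace T - M i)"
    using assms(2) by auto
  also have "\<dots> = (\<Union>i\<in>I. \<Union>(\<U> i))"
    by (intro SUP_cong refl U(4))
  also have "\<dots> = \<Union>(\<Union>i\<in>I. \<U> i)"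
    by blast
  finally have "topspace T - (\<Inter>i\<in>I. M i) = \<Union>(\<Union>i\<in>I. \<U> i)" .
  moreover have "countable (\<Union>i\<in>I. \<U> i)" using assms(1) U(1) by simp
  moreover have "\<forall>U\<in>(\<Union>i\<in>I. \<U> i). U \<subseteq> topspace T \<and> T interior_of (T closure_of U) = {}"
    using U(2,3) by simp
  moreover have "(\<Inter>i\<in>I. M i) \<subseteq> topspace T"
    using assms(2,3) unfolding comeager_in_def by blast
  ultimately show ?thesis unfolding comeager_in_def meager_in_def
    by (intro conjI exI[of _ "\<Union>i\<in>I. \<U> i"])
qed

lemma comeager_dense_open:
  assumes "openin T U" "T closure_of U = topspace T"
  shows "comeager_in T U"
proof -
  have "T interior_of (T closure_of (topspace T - U)) = {}"
    using assms by (simp add: closure_of_complement interior_of_complement interior_of_openin)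
  then show ?thesis
    unfolding comeager_in_def meager_in_def
    by (intro conjI openin_subset[OF assms(1)] exI[of _ "{topspace T - U}"]) simp_all
qed

text \<open>
  The Baire category theorem for the compact Hausdorff space of configurations over a finite alphabet.
\<close>

lemma comeager_meets_open:
  assumes "finite B" "comeager_in (config_top B) M" "openin (config_top B) U" "U \<noteq> {}"
  shows "U \<inter> M \<noteq> {}"
proof
  let ?T = "config_top B"
  assume e: "U \<inter> M = {}"
  obtain \<U> where U: "countable \<U>" "\<forall>V\<in>\<U>. V \<subseteq> topspace ?T \<and> ?T interior_of (?T closure_of V) = {}"
     "topspace ?T - M = \<Union>\<U>"
    using assms(2) unfolding comeager_in_def meager_in_def by (elim conjE exE) (rule that)
  have "compact_space ?T" "Hausdorff_space ?T"
    using assms(1) compact_space_config_top Hausdorff_space_config_top by auto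
  then have *: "locally_compact_space ?T \<and> regular_space ?T"
    using compact_Hausdorff_imp_regular_space compact_imp_locally_compact_space by blast
  have "?T interior_of \<Union>((\<lambda>V. ?T closure_of V) ` \<U>) = {}"
    by (rule Baire_category_alt) (use * U(1,2) in auto)
  moreover have "U \<subseteq> \<Union>((\<lambda>V. ?T closure_of V) ` \<U>)"
  proof
    fix x assume "x \<in> U"
    then have "x \<in> topspace ?T - M" using e openin_subset[OF assms(3)] by blast
    then obtain V where "V \<in> \<U>" "x \<in> V" using U(3) by auto
    moreover have "V \<subseteq> ?T closure_of V" using U(2) \<open>V \<in> \<U>\<close> by (intro closure_of_subset) simp
    ultimately show "x \<in> \<Union>((\<lambda>V. ?T closure_of V) ` \<U>)" by blast
  qed
  ultimately have "U \<subseteq> {}" using interior_of_maximal[OF _ assms(3)] by metis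
  with assms(4) show False by simp
qed

section \<open>Cellular automata, limit sets and generic limit sets\<close>

text \<open>
  Locality is stated with two positions \<open>i\<close> and \<open>j\<close>, so that it includes commutation with the shift:
  equal surroundings give equal images wherever they are located.
\<close>

locale local_map =
  fixes B :: "'a set" and f :: "'a config \<Rightarrow> 'a config" and r :: int
  assumes finite_alphabet: "finite B"
    and radius: "0 \<le> r"
    and closed: "x \<in> configs B \<Longrightarrow> f x \<in> configs B"
    and local: "x \<in> configs B \<Longrightarrow> y \<in> configs B \<Longrightarrow> (\<And>t. \<bar>t\<bar> \<le> r \<Longrightarrow> x (i + t) = y (j + t)) \<Longrightarrow> f x i = f y j"

lemma CA_imp_local_map:
  assumes "finite B" "cellular_automaton B f"
  obtains r where "local_map B f r"
proof -
  obtain r :: nat and F where F: "\<forall>w\<in>lists B. length w = 2 * r + 1 \<longrightarrow> F w \<in> B"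
    "\<forall>x\<in>configs B. \<forall>i. f x i = F (map (\<lambda>j. x (i + j)) [- int r..int r])"
    using assms(2) unfolding cellular_automaton_def by blast
  have "local_map B f (int r)"
  proof
    show "finite B" by (rule assms(1))
    show "0 \<le> int r" by simp
  next
    fix x assume x: "x \<in> configs B"
    have "f x i \<in> B" for i
    proof -
      have "set (map (\<lambda>j. x (i + j)) [- int r..int r]) \<subseteq> B"
        using x by (auto simp: configs_iff)
      moreover have "length (map (\<lambda>j. x (i + j)) [- int r..int r]) = 2 * r + 1" by simp
      ultimately show ?thesis using F x by (metis in_lists_conv_set subsetD)
    qed
    then show "f x \<in> configs B" by (simp add: configs_iff)
  next
    fix x y i j assume xy: "x \<in> configs B" "y \<in> configs B" and t: "\<And>t. \<bar>t\<bar> \<le> int r \<Longrightarrow> x (i + t) = y (j + t)"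
    have "map (\<lambda>k. x (i + k)) [- int r..int r] = map (\<lambda>k. y (j + k)) [- int r..int r]"
      by (rule map_cong) (auto intro!: t)
    then show "f x i = f y j" using F(2) xy by metis
  qed
  then show thesis by (rule that)
qed

lemma CA_of_local:
  fixes r :: nat
  assumes cl: "\<And>x. x \<in> configs B \<Longrightarrow> f x \<in> configs B"
    and loc: "\<And>x y i j. x \<in> configs B \<Longrightarrow> y \<in> configs B \<Longrightarrow>
       (\<And>t. \<bar>t\<bar> \<le> int r \<Longrightarrow> x (i + t) = y (j + t)) \<Longrightarrow> f x i = f y j"
  shows "cellular_automaton B f"
proof -
  define e where "e w = (\<lambda>k. if \<bar>k\<bar> \<le> int r then w ! nat (k + int r) else w ! 0)" for w :: "'a list"
  have e: "e w \<in> configs B" if "w \<in> lists B" "length w = 2 * r + 1" for w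
    using that by (auto simp: configs_iff e_def in_lists_conv_set intro!: nth_mem)
  show ?thesis
    unfolding cellular_automaton_def
  proof (intro exI[of _ r] exI[of _ "\<lambda>w. f (e w) 0"] conjI ballI impI allI)
    fix w assume "w \<in> lists B" "length w = 2 * r + 1"
    then show "f (e w) 0 \<in> B" using cl[OF e] by (simp add: configs_iff)
  next
    fix x i assume x: "x \<in> configs B"
    let ?w = "map (\<lambda>j. x (i + j)) [- int r..int r]"
    have "?w \<in> lists B" using x by (auto simp: configs_iff)
    then have "e ?w \<in> configs B" by (rule e) simp
    then show "f x i = f (e ?w) 0"
    proof (rule loc[OF x])
      fix t :: int assume t: "\<bar>t\<bar> \<le> int r"
      then have "[- int r..int r] ! nat (t + int r) = t" by (subst nth_upto) auto
      moreover have "e ?w (0 + t) = x (i + [- int r..int r] ! nat (t + int r))"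
        using t by (simp add: e_def)
      ultimately show "x (i + t) = e ?w (0 + t)" by (simp only:)
    qed
  qed
qed

context local_map
begin

lemma iterate_closed: "x \<in> configs B \<Longrightarrow> (f ^^ n) x \<in> configs B"
  by (induction n) (auto intro: closed)

lemma iterate_local:
  assumes "x \<in> configs B" "y \<in> configs B" "\<And>t. \<bar>t\<bar> \<le> int n * r \<Longrightarrow> x (i + t) = y (j + t)"
  shows "(f ^^ n) x i = (f ^^ n) y j"
  using assms(3)
proof (induction n arbitrary: i j)
  case 0
  then show ?case using 0[of 0] by simp
next
  case (Suc n)
  have "f ((f ^^ n) x) i = f ((f ^^ n) y) j"
  proof (rule local)
    fix t assume t: "\<bar>t\<bar> \<le> r"
    show "(f ^^ n) x (i + t) = (f ^^ n) y (j + t)"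
    proof (rule Suc.IH)
      fix s assume s: "\<bar>s\<bar> \<le> int n * r"
      have "\<bar>t + s\<bar> \<le> int (Suc n) * r" using t s by (simp add: algebra_simps)
      then show "x (i + t + s) = y (j + t + s)" using Suc.prems[of "t + s"] by (simp add: add.assoc)
    qed
  qed (use assms iterate_closed in auto)
  then show ?case by simp
qed

lemma iterate_local_ball:
  assumes "x \<in> configs B" "y \<in> configs B" "\<forall>i. \<bar>i\<bar> \<le> R + int n * r \<longrightarrow> y i = x i" "\<bar>i\<bar> \<le> R"
  shows "(f ^^ n) y i = (f ^^ n) x i"
proof (rule iterate_local[OF assms(2,1)])
  fix t assume "\<bar>t\<bar> \<le> int n * r"
  then show "y (i + t) = x (i + t)" using assms(3)[rule_format, of "i + t"] assms(4) by linarith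
qed

lemma omega_limit_iff:
  assumes "x \<in> configs B"
  shows "y \<in> omega_limit B f x \<longleftrightarrow>
     y \<in> configs B \<and> (\<forall>N R. \<exists>n\<ge>N. \<forall>i. \<bar>i\<bar> \<le> R \<longrightarrow> (f ^^ n) x i = y i)"
proof -
  have "y \<in> config_top B closure_of {(f ^^ n) x | n. n \<ge> N} \<longleftrightarrow>
     y \<in> configs B \<and> (\<forall>R. \<exists>n\<ge>N. \<forall>i. \<bar>i\<bar> \<le> R \<longrightarrow> (f ^^ n) x i = y i)" for N
    unfolding in_closure_of_config_top using iterate_closed[OF assms] by blast
  then show ?thesis unfolding omega_limit_def by blast
qed

lemma omega_limit_subset: "x \<in> configs B \<Longrightarrow> omega_limit B f x \<subseteq> configs B"
  by (auto simp: omega_limit_iff)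

text \<open>
  A compactness argument: the closures of the visits to \<open>Q\<close> after time \<open>N\<close> are a decreasing sequence
  of nonempty closed sets.
\<close>

lemma omega_limit_meets_closed:
  assumes x: "x \<in> configs B" and Q: "closedin (config_top B) Q" and rec: "\<And>N. \<exists>n\<ge>N. (f ^^ n) x \<in> Q"
  shows "omega_limit B f x \<inter> Q \<noteq> {}"
proof -
  define C where "C N = config_top B closure_of {(f ^^ n) x | n. n \<ge> N \<and> (f ^^ n) x \<in> Q}" for N
  have sub: "C N \<subseteq> Q" for N
    unfolding C_def by (rule closure_of_minimal[OF _ Q]) auto
  have sub': "C N \<subseteq> config_top B closure_of {(f ^^ n) x | n. n \<ge> N}" for N
    unfolding C_def by (rule closure_of_mono) auto
  have "(\<Inter>N. C N) \<noteq> {}"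
  proof (rule compact_space_imp_nest)
    show "compact_space (config_top B)" by (rule compact_space_config_top[OF finite_alphabet])
    show "closedin (config_top B) (C n)" for n unfolding C_def by simp
    show "C n \<noteq> {}" for n
    proof -
      obtain k where "k \<ge> n" "(f ^^ k) x \<in> Q" using rec by blast
      then have "(f ^^ k) x \<in> {(f ^^ i) x | i. i \<ge> n \<and> (f ^^ i) x \<in> Q} \<inter> configs B"
        using iterate_closed[OF x] by blast
      then show ?thesis unfolding C_def closure_of_eq_empty_gen disjnt_def by blast
    qed
    show "decseq C"
      unfolding decseq_def C_def by (intro allI impI closure_of_mono) auto
  qed
  then obtain y where "\<And>N. y \<in> C N" by blast
  then have "y \<in> Q" "y \<in> omega_limit B f x" using sub sub' unfolding omega_limit_def by blast+
  then show ?thesis by blast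
qed

lemma comeager_configs: "comeager_in (config_top B) (configs B)"
  by (rule comeager_dense_open) auto

lemma generic_attractor_configs: "generic_attractor B f (configs B)"
proof -
  have "attraction_realm B f (configs B) = configs B"
    unfolding attraction_realm_def using omega_limit_subset by blast
  then show ?thesis unfolding generic_attractor_def using comeager_configs by simp
qed

lemma generic_limit_subset: "generic_limit_set B f \<subseteq> configs B"
  unfolding generic_limit_set_def using generic_attractor_configs by blast

text \<open>
  By compactness of \<open>Q\<close>, finitely many generic attractors already have an intersection that misses
  \<open>Q\<close>.  A configuration attracted by all of them cannot visit \<open>Q\<close> infinitely often, as its limit set
  would meet \<open>Q\<close>.
\<close>

lemma generically_leaves_closed:
  assumes Q: "closedin (config_top B) Q" and disj: "Q \<inter> generic_limit_set B f = {}"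
  shows "comeager_in (config_top B) {x \<in> configs B. \<exists>N. \<forall>n\<ge>N. (f ^^ n) x \<notin> Q}"
proof -
  have "compactin (config_top B) Q"
    using closedin_compact_space compact_space_config_top finite_alphabet Q by blast
  then obtain \<F> where \<F>: "finite \<F>" "\<F> \<subseteq> {K. generic_attractor B f K}" "Q \<inter> \<Inter>\<F> = {}"
    using disj unfolding compactin_fip generic_limit_set_def generic_attractor_def
    by (metis (mono_tags, lifting) mem_Collect_eq)
  \<comment> \<open>The whole space is added because the finite family may be empty.\<close>
  define \<G> where "\<G> = insert (configs B) \<F>"
  have "comeager_in (config_top B) (\<Inter>K\<in>\<G>. attraction_realm B f K)"
    by (rule comeager_Inter)
      (use \<F> generic_attractor_configs in \<open>auto simp: \<G>_def generic_attractor_def countable_finite\<close>)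
  moreover have "(\<Inter>K\<in>\<G>. attraction_realm B f K) \<subseteq> {x \<in> configs B. \<exists>N. \<forall>n\<ge>N. (f ^^ n) x \<notin> Q}"
  proof
    fix x assume x: "x \<in> (\<Inter>K\<in>\<G>. attraction_realm B f K)"
    then have xB: "x \<in> configs B" by (auto simp: \<G>_def attraction_realm_def)
    have "omega_limit B f x \<subseteq> \<Inter>\<F>" using x by (auto simp: \<G>_def attraction_realm_def)
    then have "omega_limit B f x \<inter> Q = {}" using \<F>(3) by blast
    then have "\<exists>N. \<forall>n\<ge>N. (f ^^ n) x \<notin> Q" using omega_limit_meets_closed[OF xB Q] by blast
    then show "x \<in> {x \<in> configs B. \<exists>N. \<forall>n\<ge>N. (f ^^ n) x \<notin> Q}" using xB by blast
  qed
  ultimately show ?thesis by (rule comeager_mono) auto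
qed

text \<open>
  Limit sets are invariant under \<open>f\<close>, so the preimage of a generic attractor attracts at least as many
  configurations and is a generic attractor itself.
\<close>

lemma generic_limit_invariant:
  assumes "x \<in> generic_limit_set B f"
  shows "f x \<in> generic_limit_set B f"
  unfolding generic_limit_set_def
proof (intro InterI, unfold mem_Collect_eq)
  fix K assume K: "generic_attractor B f K"
  define K' where "K' = {y \<in> configs B. f y \<in> K}"
  have "closedin (config_top B) K'"
    unfolding closedin_config_top_iff
  proof (intro conjI ballI impI)
    fix y assume y: "y \<in> configs B" "\<forall>R. \<exists>z\<in>K'. \<forall>i. \<bar>i\<bar> \<le> R \<longrightarrow> z i = y i"
    have "\<exists>z\<in>K. \<forall>i. \<bar>i\<bar> \<le> R \<longrightarrow> z i = f y i" for R
    proof -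
      obtain z where z: "z \<in> K'" "\<forall>i. \<bar>i\<bar> \<le> R + int 1 * r \<longrightarrow> z i = y i" using y(2) by blast
      then have "z \<in> configs B" by (simp add: K'_def)
      from iterate_local_ball[OF y(1) this z(2)] z(1) show ?thesis by (auto simp: K'_def)
    qed
    moreover have "closedin (config_top B) K" using K by (simp add: generic_attractor_def)
    ultimately have "f y \<in> K" using closed[OF y(1)] unfolding closedin_config_top_iff by blast
    then show "y \<in> K'" using y(1) by (simp add: K'_def)
  qed (auto simp: K'_def)
  moreover have "comeager_in (config_top B) (attraction_realm B f K')"
  proof (rule comeager_mono)
    show "comeager_in (config_top B) (attraction_realm B f K)" using K by (simp add: generic_attractor_def)
    show "attraction_realm B f K \<subseteq> attraction_realm B f K'"
    proof
      fix z assume z: "z \<in> attraction_realm B f K"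
      then have zB: "z \<in> configs B" and zK: "omega_limit B f z \<subseteq> K" by (auto simp: attraction_realm_def)
      have "y \<in> K'" if y: "y \<in> omega_limit B f z" for y
      proof -
        have yB: "y \<in> configs B" and yw: "\<And>N R. \<exists>n\<ge>N. \<forall>i. \<bar>i\<bar> \<le> R \<longrightarrow> (f ^^ n) z i = y i"
          using y omega_limit_iff[OF zB] by blast+
        have "\<exists>n\<ge>N. \<forall>i. \<bar>i\<bar> \<le> R \<longrightarrow> (f ^^ n) z i = f y i" for N R
        proof -
          obtain n where n: "n \<ge> N" "\<forall>i. \<bar>i\<bar> \<le> R + int 1 * r \<longrightarrow> (f ^^ n) z i = y i" using yw by blast
          have "\<forall>i. \<bar>i\<bar> \<le> R \<longrightarrow> (f ^^ Suc n) z i = f y i"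
            using iterate_local_ball[OF yB iterate_closed[OF zB] n(2)] by simp
          with n(1) show ?thesis by (meson le_SucI)
        qed
        then have "f y \<in> omega_limit B f z" using omega_limit_iff[OF zB] closed[OF yB] by blast
        then show ?thesis using zK yB by (auto simp: K'_def)
      qed
      then show "z \<in> attraction_realm B f K'" using zB by (auto simp: attraction_realm_def)
    qed
  qed (auto simp: attraction_realm_def)
  ultimately have "generic_attractor B f K'" by (simp add: generic_attractor_def)
  then have "x \<in> K'" using assms by (auto simp: generic_limit_set_def)
  then show "f x \<in> K" by (simp add: K'_def)
qed

end

section \<open>Subshifts determined by their windows\<close>

definition word :: "'a config \<Rightarrow> int \<Rightarrow> nat \<Rightarrow> 'a list" where
  "word x i n = map (\<lambda>k. x (i + int k)) [0..<n]"

lemma length_word [simp]: "length (word x i n) = n"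
  by (simp add: word_def)

lemma word_eq_iff:
  "word x i n = word y j n \<longleftrightarrow> (\<forall>t. 0 \<le> t \<and> t < int n \<longrightarrow> x (i + t) = y (j + t))"
proof
  assume w: "word x i n = word y j n"
  have "x (i + t) = y (j + t)" if "0 \<le> t" "t < int n" for t
  proof -
    have "nat t < n" using that by linarith
    then show ?thesis using arg_cong[OF w, of "\<lambda>l. l ! nat t"] that by (simp add: word_def)
  qed
  then show "\<forall>t. 0 \<le> t \<and> t < int n \<longrightarrow> x (i + t) = y (j + t)" by blast
next
  assume e: "\<forall>t. 0 \<le> t \<and> t < int n \<longrightarrow> x (i + t) = y (j + t)"
  show "word x i n = word y j n"
    unfolding word_def by (rule map_cong[OF refl]) (use e in simp)
qed

lemma word_translate: "word (\<lambda>k. x (k + j)) i n = word x (i + j) n"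
  by (simp add: word_def ac_simps)

lemma word_append: "word x i (n + k) = word x i n @ word x (i + int n) k"
proof -
  have "[0..<n + k] = [0..<n] @ map (\<lambda>t. t + n) [0..<k]"
    unfolding upt_add_eq_append[OF le0] map_add_upt by (simp add: add.commute)
  then show ?thesis by (simp add: word_def ac_simps)
qed

lemma occurs_in_iff_word: "occurs_in w x \<longleftrightarrow> (\<exists>i. word x i (length w) = w)"
proof -
  have "(\<forall>k<length w. x (i + int k) = w ! k) \<longleftrightarrow> word x i (length w) = w" for i
    unfolding list_eq_iff_nth_eq by (simp add: word_def)
  then show ?thesis unfolding occurs_in_def by simp
qed

text \<open>
  The combinatorial content of being a subshift of finite type: membership is decided by the windows
  of length \<open>m\<close>.  The set of admissible windows is taken to be the set of those that occur in \<open>X\<close>, so that no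
  separate list of forbidden words has to be carried around.
\<close>

locale window_shift =
  fixes A :: "'a set" and X :: "'a config set" and m :: nat
  assumes window_pos: "0 < m"
    and sub_configs: "X \<subseteq> configs A"
    and translate: "x \<in> X \<Longrightarrow> (\<lambda>k. x (k + j)) \<in> X"
    and complete: "x \<in> configs A \<Longrightarrow> (\<And>i. word x i m \<in> (\<lambda>y. word y 0 m) ` X) \<Longrightarrow> x \<in> X"
begin

definition windows :: "'a list set" where
  "windows = (\<lambda>y. word y 0 m) ` X"

lemma word_in_windows: "x \<in> X \<Longrightarrow> word x i m \<in> windows"
  unfolding windows_def using translate[of x i]
  by (intro image_eqI[of _ _ "\<lambda>k. x (k + i)"]) (simp_all add: word_translate[of x i])

lemma lang_iff: "w \<in> lang X \<longleftrightarrow> (\<exists>x\<in>X. word x 0 (length w) = w)"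
proof
  assume "w \<in> lang X"
  then obtain x i where "x \<in> X" "word x i (length w) = w"
    unfolding lang_def occurs_in_iff_word by blast
  then show "\<exists>x\<in>X. word x 0 (length w) = w" using translate[of x i]
    by (intro bexI[of _ "\<lambda>k. x (k + i)"]) (simp_all add: word_translate[of x i])
next
  assume "\<exists>x\<in>X. word x 0 (length w) = w"
  then show "w \<in> lang X" unfolding lang_def occurs_in_iff_word by blast
qed

lemma word_in_lang:
  assumes "x \<in> X"
  shows "word x i n \<in> lang X"
proof -
  have "occurs_in (word x i n) x" unfolding occurs_in_iff_word length_word by (rule exI) (rule refl)
  then show ?thesis unfolding lang_def using assms by (intro CollectI bexI)
qed

lemma windows_subset_lang: "windows \<subseteq> lang X"
  unfolding windows_def by (rule image_subsetI) (rule word_in_lang)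

text \<open>
  A window of the spliced configuration lies entirely in the part taken from \<open>x\<close> or entirely in the part taken
  from \<open>y\<close>, since both parts overlap in a full window.
\<close>

lemma glue:
  assumes x: "x \<in> X" and y: "y \<in> X" and eq: "word x i m = word y j m"
  obtains z where "z \<in> X" "\<And>k. k < i + int m \<Longrightarrow> z k = x k" "\<And>k. i \<le> k \<Longrightarrow> z k = y (k - i + j)"
proof -
  define z where "z k = (if k < i + int m then x k else y (k - i + j))" for k
  have right: "z k = y (k - i + j)" if "i \<le> k" for k
    using that eq[unfolded word_eq_iff, rule_format, of "k - i"] by (simp add: z_def algebra_simps)
  have "z \<in> X"
  proof (rule complete)
    show "z \<in> configs A" using x y sub_configs by (auto simp: z_def configs_iff)
    fix l
    have "word z l m = word x l m \<or> word z l m = word y (l - i + j) m"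
    proof (cases "l \<le> i")
      case True
      then show ?thesis by (auto simp: word_eq_iff z_def)
    next
      case False
      then have "word z l m = word y (l - i + j) m"
        unfolding word_eq_iff by (auto simp: right algebra_simps)
      then show ?thesis by blast
    qed
    then show "word z l m \<in> (\<lambda>y. word y 0 m) ` X"
      using word_in_windows x y unfolding windows_def by metis
  qed
  then show thesis using that right by (simp add: z_def)
qed

definition reach :: "'a list \<Rightarrow> int \<Rightarrow> 'a list \<Rightarrow> bool" where
  "reach u d v \<longleftrightarrow> (\<exists>x\<in>X. word x 0 m = u \<and> word x d m = v)"

lemma reach_trans:
  assumes "reach u d v" "reach v e w" "0 \<le> d" "0 \<le> e"
  shows "reach u (d + e) w"
proof -
  obtain x y where x: "x \<in> X" "word x 0 m = u" "word x d m = v"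
    and y: "y \<in> X" "word y 0 m = v" "word y e m = w"
    using assms unfolding reach_def by blast
  have "word x d m = word y 0 m" using x y by simp
  then obtain z where z: "z \<in> X" "\<And>k. k < d + int m \<Longrightarrow> z k = x k" "\<And>k. d \<le> k \<Longrightarrow> z k = y (k - d + 0)"
    by (rule glue[OF x(1) y(1)]) (rule that)
  have "word z 0 m = u" using z(2) assms(3) x(2) unfolding word_def by force
  moreover have "word z (d + e) m = word y e m"
    unfolding word_eq_iff using z(3) assms(4) by (simp add: algebra_simps)
  ultimately show ?thesis unfolding reach_def using z(1) y(3) by blast
qed

lemma reach_same: "u \<in> windows \<Longrightarrow> reach u 0 u"
  unfolding reach_def windows_def by auto

lemma reach_within: "x \<in> X \<Longrightarrow> reach (word x i m) d (word x (i + d) m)"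
  unfolding reach_def using translate[of x i] by (intro bexI[of _ "\<lambda>k. x (k + i)"]) (simp_all add: word_translate[of x i] add.commute)

text \<open>
  The offset \<open>m\<close> arises because \<open>reach\<close> measures the distance between the starting points of the two
  windows, whereas \<open>w\<close> is the word strictly between them.
\<close>

lemma reach_of_lang:
  assumes "u \<in> windows" "v \<in> windows" "u @ w @ v \<in> lang X"
  shows "reach u (int m + int (length w)) v"
proof -
  have len: "length u = m" "length v = m" using assms by (auto simp: windows_def)
  obtain x where x: "x \<in> X" "word x 0 (m + (length w + m)) = u @ w @ v"
    using assms(3) len by (auto simp: lang_iff)
  have "word x 0 m = u" "word x (int m + int (length w)) m = v"
    using x(2) len unfolding word_append by (auto simp: add.commute)
  then show ?thesis unfolding reach_def using x(1) by blast
qed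

text \<open>
  Over a finite alphabet there are finitely many pairs of windows, so the thresholds in the definition of
  mixing have a maximum.
\<close>

lemma mixing_uniform_gap:
  assumes "finite A" "mixing_shift X"
  obtains N :: int where "int m \<le> N" "\<And>u v d. u \<in> windows \<Longrightarrow> v \<in> windows \<Longrightarrow> N \<le> d \<Longrightarrow> reach u d v"
proof -
  have "windows \<subseteq> {w. set w \<subseteq> A \<and> length w = m}"
  proof (unfold windows_def, rule image_subsetI)
    fix x assume "x \<in> X"
    then have "\<And>i. x i \<in> A" using sub_configs unfolding configs_iff subset_iff by blast
    then show "word x 0 m \<in> {w. set w \<subseteq> A \<and> length w = m}" by (auto simp: word_def)
  qed
  then have fin: "finite windows" using finite_lists_length_eq[OF assms(1)] by (rule finite_subset)
  have ex: "\<forall>u\<in>windows. \<forall>v\<in>windows. \<exists>N. \<forall>n\<ge>N. \<exists>w\<in>lang X. length w = n \<and> u @ w @ v \<in> lang X"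
    using assms(2) windows_subset_lang unfolding mixing_shift_def by blast
  define M where "M u v = (SOME N. \<forall>n\<ge>N. \<exists>w\<in>lang X. length w = n \<and> u @ w @ v \<in> lang X)" for u v
  have M: "\<exists>w\<in>lang X. length w = n \<and> u @ w @ v \<in> lang X"
    if "u \<in> windows" "v \<in> windows" "M u v \<le> n" for u v n
    using someI_ex[OF ex[rule_format, OF that(1,2)]] that(3) unfolding M_def by blast
  define K where "K = Max (insert 0 ((\<lambda>(u, v). M u v) ` (windows \<times> windows)))"
  have K: "M u v \<le> K" if "u \<in> windows" "v \<in> windows" for u v
    unfolding K_def using fin that by (intro Max_ge) auto
  show thesis
  proof (rule that[of "int m + int K"])
    fix u v d assume uv: "u \<in> windows" "v \<in> windows" and d: "int m + int K \<le> d"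
    then have "M u v \<le> nat (d - int m)" using K[OF uv] by linarith
    then obtain w where w: "length w = nat (d - int m)" "u @ w @ v \<in> lang X" using M[OF uv] by blast
    have "int m + int (length w) = d" using w(1) d by linarith
    then show "reach u d v" using reach_of_lang[OF uv w(2)] by simp
  qed simp
qed

lemma reach_exists:
  assumes "transitive_shift X" "u \<in> windows" "v \<in> windows"
  shows "\<exists>d\<ge>1. reach u d v"
proof -
  have "u \<in> lang X" "v \<in> lang X" using assms windows_subset_lang by blast+
  then obtain w where w: "u @ w @ v \<in> lang X"
    using assms(1) unfolding transitive_shift_def by blast
  have "1 \<le> int m + int (length w)" using window_pos by simp
  then show ?thesis using reach_of_lang[OF assms(2,3) w] by blast
qed

text \<open>
  It suffices to control the returns to a single window \<open>u0\<close>: given words \<open>u\<close> and \<open>v\<close>, leave the window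
  that follows \<open>u\<close>, pass to \<open>u0\<close>, spend the surplus time returning to \<open>u0\<close>, and then go to the window
  that precedes \<open>v\<close>.
\<close>

lemma mixing_of_reach:
  assumes trans: "transitive_shift X" and u0: "u0 \<in> windows" and N: "\<And>d. N \<le> d \<Longrightarrow> reach u0 d u0"
  shows "mixing_shift X"
  unfolding mixing_shift_def
proof (intro conjI ballI)
  show "transitive_shift X" by fact
  fix u v assume "u \<in> lang X" "v \<in> lang X"
  then obtain x y where x: "x \<in> X" "word x 0 (length u) = u" and y: "y \<in> X" "word y 0 (length v) = v"
    by (auto simp: lang_iff)
  \<comment> \<open>The windows directly after an occurrence of \<open>u\<close> and directly before an occurrence of \<open>v\<close>.\<close>
  define a where "a = word x (int (length u)) m"
  define b where "b = word y (- int m) m"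
  have ab: "a \<in> windows" "b \<in> windows" using x y word_in_windows by (auto simp: a_def b_def)
  obtain d e where d: "d \<ge> 1" "reach a d u0" and e: "e \<ge> 1" "reach u0 e b"
    using reach_exists[OF trans ab(1) u0] reach_exists[OF trans u0 ab(2)] by blast
  show "\<exists>K. \<forall>n\<ge>K. \<exists>w\<in>lang X. length w = n \<and> u @ w @ v \<in> lang X"
  proof (intro exI allI impI)
    fix n :: nat assume n: "nat (d + \<bar>N\<bar> + e + int m) \<le> n"
    \<comment> \<open>The windows \<open>a\<close> and \<open>b\<close> both lie inside the connecting word of length \<open>n\<close>.\<close>
    define D where "D = int n - int m"
    have D: "D \<ge> 0" "d + \<bar>N\<bar> + e \<le> D" using n d e by (auto simp: D_def)
    have "reach a (d + (D - d - e)) u0" by (rule reach_trans[OF d(2) N]) (use d D in auto)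
    then have "reach a (d + (D - d - e) + e) b" by (rule reach_trans[OF _ e(2)]) (use d e D in auto)
    then obtain z where z: "z \<in> X" "word z 0 m = a" "word z D m = b"
      unfolding reach_def by (elim bexE conjE) (rule that, simp_all)
    have "word x (int (length u)) m = word z 0 m" using z(2) a_def by simp
    then obtain z1 where z1: "z1 \<in> X" "\<And>k. k < int (length u) + int m \<Longrightarrow> z1 k = x k"
      "\<And>k. int (length u) \<le> k \<Longrightarrow> z1 k = z (k - int (length u) + 0)"
      by (rule glue[OF x(1) z(1)]) (rule that)
    have "word z1 (int (length u) + D) m = word z D m"
      unfolding word_eq_iff using D(1) by (simp add: z1(3))
    then have *: "word z1 (int (length u) + D) m = word y (- int m) m" using z(3) b_def by simp
    obtain z2 where z2: "z2 \<in> X" "\<And>k. k < int (length u) + D + int m \<Longrightarrow> z2 k = z1 k"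
      "\<And>k. int (length u) + D \<le> k \<Longrightarrow> z2 k = y (k - (int (length u) + D) + (- int m))"
      using * by (rule glue[OF z1(1) y(1)]) (rule that)
    have n_eq: "int n = D + int m" by (simp add: D_def)
    have "word z2 0 (length u) = word x 0 (length u)"
      unfolding word_eq_iff using D(1) by (simp add: z2(2) z1(2))
    moreover have "word z2 (int (length u) + int n) (length v) = word y 0 (length v)"
      unfolding word_eq_iff n_eq by (simp add: z2(3))
    ultimately have "word z2 0 (length u + (n + length v)) = u @ word z2 (int (length u)) n @ v"
      unfolding word_append using x(2) y(2) by simp
    with word_in_lang[OF z2(1), of 0 "length u + (n + length v)"]
    have "u @ word z2 (int (length u)) n @ v \<in> lang X" by simp
    then show "\<exists>w\<in>lang X. length w = n \<and> u @ w @ v \<in> lang X"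
      using word_in_lang[OF z2(1)] by (intro bexI[of _ "word z2 (int (length u)) n"] conjI) simp_all
  qed
qed

end

text \<open>
  Any length exceeding that of all forbidden words works: a forbidden word at some position is a prefix
  of the window there, which occurs in \<open>X\<close>.
\<close>

lemma SFT_window:
  assumes "SFT A X"
  obtains m where "window_shift A X m"
proof -
  obtain F where F: "finite F" "X = {x \<in> configs A. \<forall>w\<in>F. \<not> occurs_in w x}"
    using assms unfolding SFT_def by blast
  define m where "m = Suc (Max (insert 0 (length ` F)))"
  have len: "length w \<le> m" if "w \<in> F" for w
    unfolding m_def using F(1) that by (intro le_SucI Max_ge) auto
  have "window_shift A X m"
  proof
    show "0 < m" by (simp add: m_def)
    show "X \<subseteq> configs A" using F(2) by auto
  next
    fix x j assume "x \<in> X"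
    then show "(\<lambda>k. x (k + j)) \<in> X"
      unfolding F(2) configs_iff occurs_in_iff_word by (simp add: word_translate[of x j])
  next
    fix x assume x: "x \<in> configs A" "\<And>i. word x i m \<in> (\<lambda>y. word y 0 m) ` X"
    have False if w: "w \<in> F" "word x i (length w) = w" for w i
    proof -
      obtain y where y: "y \<in> X" "word x i m = word y 0 m" using x(2)[of i] by blast
      then have "word x i (length w) = word y 0 (length w)"
        using len[OF w(1)] unfolding word_eq_iff by simp
      then have "word y 0 (length w) = w" using w(2) by simp
      then have "occurs_in w y" unfolding occurs_in_iff_word by (rule exI)
      then show False using y(1) w(1) F(2) by blast
    qed
    then show "x \<in> X" using x(1) unfolding F(2) occurs_in_iff_word by blast
  qed
  then show thesis by (rule that)
qed

section \<open>The period of a transitive subshift of finite type\<close>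

context window_shift begin

lemma reach_windows: "reach u d v \<Longrightarrow> u \<in> windows \<and> v \<in> windows"
  unfolding reach_def using word_in_windows by blast

lemma reach_multiple: "u \<in> windows \<Longrightarrow> reach u a u \<Longrightarrow> 0 \<le> a \<Longrightarrow> reach u (int n * a) u"
proof (induction n)
  case 0
  then show ?case by (simp add: reach_same)
next
  case (Suc n)
  have "reach u (int n * a + a) u"
    by (rule reach_trans[OF Suc.IH[OF Suc.prems] Suc.prems(2)]) (use Suc.prems(3) in simp_all)
  then show ?case by (simp add: distrib_right add.commute)
qed

text \<open>
  The two-coin problem for \<open>b\<close> and \<open>b + 1\<close>: if \<open>d = q * b + s\<close> with \<open>s < b \<le> q\<close>, then
  \<open>d = (q - s) * b + s * (b + 1)\<close>.
\<close>

lemma consecutive_returns: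
  assumes u: "u \<in> windows" and b: "0 \<le> b" "reach u b u" "reach u (b + 1) u" and d: "b * b \<le> d"
  shows "reach u d u"
proof (cases "b = 0")
  case True
  then show ?thesis using reach_multiple[OF u, of 1 "nat d"] b d by simp
next
  case False
  define q s where "q = d div b" and "s = d mod b"
  have qs: "d = q * b + s" "0 \<le> s" "s < b" using False b(1) by (simp_all add: q_def s_def)
  have "b \<le> q" using zdiv_mono1[OF d, of b] False b(1) by (simp add: q_def)
  then have "0 \<le> q - s" using qs by simp
  have "reach u (int (nat (q - s)) * b + int (nat s) * (b + 1)) u"
    by (rule reach_trans[OF reach_multiple[OF u b(2,1)] reach_multiple[OF u b(3)]]) (use b(1) in simp_all)
  moreover have "int (nat (q - s)) * b + int (nat s) * (b + 1) = d"
    using \<open>0 \<le> q - s\<close> qs by (simp add: algebra_simps)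
  ultimately show ?thesis by simp
qed

text \<open>
  The differences of return times to a window \<open>u\<close> form a subgroup of the integers, generated by its least
  positive element \<open>p\<close>.  The phase of a window is the time of some passage from \<open>u\<close> to it; any two such times
  differ by a multiple of \<open>p\<close>, because both can be completed to returns by the same passage back.  If
  \<open>p = 1\<close>, then two consecutive return times exist and \<open>consecutive_returns\<close> gives all large ones.
\<close>

lemma phase_exists:
  assumes trans: "transitive_shift X" and nonempty: "X \<noteq> {}"
  obtains p :: int and \<theta> :: "'a list \<Rightarrow> int"
  where "0 < p" "\<And>u d v. reach u d v \<Longrightarrow> 0 \<le> d \<Longrightarrow> p dvd \<theta> v - \<theta> u - d"
    "p = 1 \<Longrightarrow> mixing_shift X"
proof -
  obtain u where u: "u \<in> windows" using nonempty word_in_windows by blast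
  define T where "T = {d. 0 \<le> d \<and> reach u d u}"
  have T0: "0 \<in> T" using reach_same[OF u] by (simp add: T_def)
  have Tadd: "a + b \<in> T" if "a \<in> T" "b \<in> T" for a b
    using that reach_trans[of u a u b u] by (simp add: T_def)
  define D where "D = {a - b | a b. a \<in> T \<and> b \<in> T}"
  have Dsub: "c - d \<in> D" if cd: "c \<in> D" "d \<in> D" for c d
  proof -
    obtain a1 b1 a2 b2 where *: "c = a1 - b1" "d = a2 - b2" "a1 \<in> T" "b1 \<in> T" "a2 \<in> T" "b2 \<in> T"
      using cd unfolding D_def by blast
    have "c - d = (a1 + b2) - (b1 + a2)" using * by simp
    then show ?thesis unfolding D_def using Tadd * by blast
  qed
  have TD: "a \<in> D" if "a \<in> T" for a
    unfolding D_def using that T0 by (intro CollectI exI[of _ a] exI[of _ 0]) simp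
  have D0: "0 \<in> D" using TD T0 .
  have Dadd: "c + d \<in> D" if "c \<in> D" "d \<in> D" for c d
    using Dsub[OF that(1) Dsub[OF D0 that(2)]] by simp
  obtain d where d: "d \<ge> 1" "reach u d u" using reach_exists[OF trans u u] by blast
  define p where "p = (LEAST k. 0 < k \<and> int k \<in> D)"
  have ex: "0 < nat d \<and> int (nat d) \<in> D" using d TD by (simp add: T_def)
  have p: "0 < p" "int p \<in> D" using LeastI[of "\<lambda>k. 0 < k \<and> int k \<in> D", OF ex] by (simp_all add: p_def)
  have mult: "k * int p \<in> D" for k :: int
  proof (induction k rule: int_induct[where k = 0])
    case base
    then show ?case using D0 by simp
  next
    case (step1 i)
    then show ?case using Dadd[OF _ p(2)] by (simp add: distrib_right)
  next
    case (step2 i)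
    then show ?case using Dsub[OF _ p(2)] by (simp add: left_diff_distrib)
  qed
  have dvd: "int p dvd z" if "z \<in> D" for z
  proof -
    have "z - z div int p * int p \<in> D" by (rule Dsub[OF that mult])
    then have "z mod int p \<in> D" by (simp add: minus_div_mult_eq_mod)
    moreover have "nat (z mod int p) < p" using p(1) by (simp add: nat_less_iff)
    then have "\<not> (0 < nat (z mod int p) \<and> int (nat (z mod int p)) \<in> D)"
      unfolding p_def by (rule not_less_Least)
    moreover have "0 \<le> z mod int p" using p(1) by simp
    ultimately have "z mod int p = 0" by auto
    then show ?thesis by (simp add: dvd_eq_mod_eq_0)
  qed
  define \<theta> where "\<theta> v = (SOME e. 0 \<le> e \<and> reach u e v)" for v
  have \<theta>: "0 \<le> \<theta> v \<and> reach u (\<theta> v) v" if v: "v \<in> windows" for v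
  proof -
    obtain e where "e \<ge> 1" "reach u e v" using reach_exists[OF trans u v] by blast
    then have "0 \<le> e \<and> reach u e v" by simp
    then show ?thesis unfolding \<theta>_def by (rule someI)
  qed
  show thesis
  proof (rule that[of "int p" \<theta>])
    show "0 < int p" using p(1) by simp
  next
    fix v1 e v2 assume e: "reach v1 e v2" "0 \<le> e"
    have v: "v1 \<in> windows" "v2 \<in> windows" using reach_windows[OF e(1)] by auto
    obtain c where c: "c \<ge> 1" "reach v2 c u" using reach_exists[OF trans v(2) u] by blast
    have t1: "reach u (\<theta> v1) v1" "0 \<le> \<theta> v1" and t2: "reach u (\<theta> v2) v2" "0 \<le> \<theta> v2"
      using \<theta>[OF v(1)] \<theta>[OF v(2)] by auto
    have "reach u (\<theta> v1 + e) v2" using reach_trans[OF t1(1) e(1) t1(2) e(2)] .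
    then have "reach u (\<theta> v1 + e + c) u" by (rule reach_trans[OF _ c(2)]) (use t1 e c in auto)
    then have 1: "\<theta> v1 + e + c \<in> T" using t1 e c by (simp add: T_def)
    have "reach u (\<theta> v2 + c) u" by (rule reach_trans[OF t2(1) c(2)]) (use t2 c in auto)
    then have "\<theta> v2 + c \<in> T" using t2 c by (simp add: T_def)
    then have "(\<theta> v2 + c) - (\<theta> v1 + e + c) \<in> D" using 1 unfolding D_def by blast
    then have "int p dvd (\<theta> v2 + c) - (\<theta> v1 + e + c)" by (rule dvd)
    then show "int p dvd \<theta> v2 - \<theta> v1 - e" by (simp add: algebra_simps)
  next
    assume "int p = 1"
    then obtain a b where ab: "a \<in> T" "b \<in> T" "1 = a - b" using p(2) unfolding D_def by auto
    then have "a = b + 1" by simp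
    with ab have "0 \<le> b" "reach u b u" "reach u (b + 1) u" by (simp_all add: T_def)
    from consecutive_returns[OF u this] show "mixing_shift X" by (rule mixing_of_reach[OF trans u])
  qed
qed

end

section \<open>Transitive generic limit sets of finite type are mixing\<close>

locale generic_window_shift = local_map B f r + window_shift A X m
  for A B :: "'a set" and f r X m +
  assumes generic: "X = generic_limit_set B f"
    and trans: "transitive_shift X" and nonempty: "X \<noteq> {}"
begin

lemma X_configs: "x \<in> X \<Longrightarrow> x \<in> configs B"
  using generic_limit_subset generic by blast

lemma X_invariant: "x \<in> X \<Longrightarrow> f x \<in> X"
  using generic_limit_invariant generic by blast

lemma word_iterate:
  assumes "x \<in> configs B" "y \<in> configs B"
    and "\<And>t. - (int k * r) \<le> t \<Longrightarrow> t < int n + int k * r \<Longrightarrow> x (i + t) = y (j + t)"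
  shows "word ((f ^^ k) x) i n = word ((f ^^ k) y) j n"
  unfolding word_eq_iff
proof (intro allI impI)
  fix t :: int assume t: "0 \<le> t \<and> t < int n"
  show "(f ^^ k) x (i + t) = (f ^^ k) y (j + t)"
  proof (rule iterate_local[OF assms(1,2)])
    fix s assume "\<bar>s\<bar> \<le> int k * r"
    then have "x (i + (t + s)) = y (j + (t + s))" using t by (intro assms(3)) linarith+
    then show "x (i + t + s) = y (j + t + s)" by (simp add: add.assoc)
  qed
qed

text \<open>
  The configurations showing a word outside the language at position \<open>i\<close> form a clopen set disjoint
  from \<open>X\<close>.
\<close>

lemma settles:
  "comeager_in (config_top B) {x \<in> configs B. \<exists>N. \<forall>k\<ge>N. word ((f ^^ k) x) i n \<in> lang X}"
proof -
  define Q where "Q = {y \<in> configs B. word y i n \<notin> lang X}"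
  have "closedin (config_top B) Q"
    unfolding Q_def
  proof (rule clopen_of_local(2)[where R = "\<bar>i\<bar> + int n"])
    fix x y assume xy: "\<forall>k. \<bar>k\<bar> \<le> \<bar>i\<bar> + int n \<longrightarrow> y k = (x k :: 'a)"
    have "word x i n = word y i n"
      unfolding word_eq_iff
    proof (intro allI impI)
      fix t assume "0 \<le> t \<and> t < int n"
      then have "\<bar>i + t\<bar> \<le> \<bar>i\<bar> + int n" by linarith
      then show "x (i + t) = y (i + t)" using xy by simp
    qed
    then show "(word x i n \<notin> lang X) = (word y i n \<notin> lang X)" by simp
  qed
  moreover have "Q \<inter> generic_limit_set B f = {}"
    unfolding Q_def generic[symmetric] using word_in_lang by blast
  ultimately have "comeager_in (config_top B) {x \<in> configs B. \<exists>N. \<forall>k\<ge>N. (f ^^ k) x \<notin> Q}"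
    by (rule generically_leaves_closed)
  moreover have "{x \<in> configs B. \<exists>N. \<forall>k\<ge>N. (f ^^ k) x \<notin> Q}
      = {x \<in> configs B. \<exists>N. \<forall>k\<ge>N. word ((f ^^ k) x) i n \<in> lang X}"
    unfolding Q_def using iterate_closed by blast
  ultimately show ?thesis by simp
qed

text \<open>
  If every \<open>G N\<close>, the open set of configurations that still violate the language at some time after \<open>N\<close>,
  were dense, then a generic configuration would violate it infinitely often, contrary to \<open>settles\<close>.
\<close>

lemma settling_cylinder:
  obtains x0 and N R :: nat where "x0 \<in> configs B"
    "\<And>x k. x \<in> configs B \<Longrightarrow> \<forall>t. \<bar>t\<bar> \<le> int R \<longrightarrow> x t = x0 t \<Longrightarrow> N \<le> k \<Longrightarrow> word ((f ^^ k) x) i n \<in> lang X"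
proof -
  let ?T = "config_top B"
  define G where "G N = {x \<in> configs B. \<exists>k\<ge>N. word ((f ^^ k) x) i n \<notin> lang X}" for N
  have G_open: "openin ?T (G N)" for N
    unfolding openin_config_top_iff
  proof (intro conjI ballI)
    show "G N \<subseteq> configs B" unfolding G_def by (rule Collect_restrict)
    fix x assume "x \<in> G N"
    then obtain k where x: "x \<in> configs B" and k: "k \<ge> N" "word ((f ^^ k) x) i n \<notin> lang X"
      unfolding G_def by blast
    define R where "R = \<bar>i\<bar> + int n + int k * r"
    have "y \<in> G N" if y: "y \<in> configs B" "\<forall>t. \<bar>t\<bar> \<le> R \<longrightarrow> y t = x t" for y
    proof -
      have "word ((f ^^ k) y) i n = word ((f ^^ k) x) i n"
      proof (rule word_iterate[OF y(1) x])
        fix t assume "- (int k * r) \<le> t" "t < int n + int k * r"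
        then have "\<bar>i + t\<bar> \<le> R" unfolding R_def by linarith
        then show "y (i + t) = x (i + t)" using y(2) by simp
      qed
      with k y(1) show ?thesis unfolding G_def by auto
    qed
    then show "\<exists>R. \<forall>y\<in>configs B. (\<forall>t. \<bar>t\<bar> \<le> R \<longrightarrow> y t = x t) \<longrightarrow> y \<in> G N" by blast
  qed
  have "\<exists>N. ?T closure_of (G N) \<noteq> configs B"
  proof (rule ccontr)
    assume "\<not> ?thesis"
    then have "comeager_in ?T (G N)" for N using comeager_dense_open[OF G_open] by simp
    then have 1: "comeager_in ?T (\<Inter>N\<in>UNIV. G N)" by (intro comeager_Inter) simp_all
    define S where "S b = (if b then (\<Inter>N. G N)
      else {x \<in> configs B. \<exists>N. \<forall>k\<ge>N. word ((f ^^ k) x) i n \<in> lang X})" for b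
    have "comeager_in ?T (\<Inter>b\<in>UNIV. S b)"
      by (rule comeager_Inter) (use 1 settles in \<open>simp_all add: S_def\<close>)
    moreover have "configs B \<noteq> {}" using nonempty X_configs by blast
    ultimately have "configs B \<inter> (\<Inter>b. S b) \<noteq> {}"
      by (intro comeager_meets_open[OF finite_alphabet]) simp_all
    then obtain x where x: "x \<in> S b" for b by blast
    have "\<exists>N. \<forall>k\<ge>N. word ((f ^^ k) x) i n \<in> lang X" using x[of False] by (simp add: S_def)
    moreover have "\<exists>k\<ge>N. word ((f ^^ k) x) i n \<notin> lang X" for N
      using x[of True] by (simp add: S_def G_def)
    ultimately show False by blast
  qed
  then obtain N where "?T closure_of (G N) \<noteq> configs B" by blast
  then obtain x0 where x0: "x0 \<in> configs B" "x0 \<notin> ?T closure_of (G N)"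
    using closure_of_subset_topspace[of ?T "G N"] by blast
  then obtain R where R: "\<not> (\<exists>y\<in>G N \<inter> configs B. \<forall>t. \<bar>t\<bar> \<le> R \<longrightarrow> y t = x0 t)"
    unfolding in_closure_of_config_top by blast
  show thesis
  proof (rule that[OF x0(1)])
    fix x k assume x: "x \<in> configs B" "\<forall>t. \<bar>t\<bar> \<le> int (nat R) \<longrightarrow> x t = x0 t" and k: "N \<le> k"
    have "\<forall>t. \<bar>t\<bar> \<le> R \<longrightarrow> x t = x0 t"
    proof (intro allI impI)
      fix t assume "\<bar>t\<bar> \<le> R"
      then have "\<bar>t\<bar> \<le> int (nat R)" by linarith
      then show "x t = x0 t" using x(2) by blast
    qed
    then have "x \<notin> G N" using R x(1) by blast
    then show "word ((f ^^ k) x) i n \<in> lang X" using x(1) k unfolding G_def by blast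
  qed
qed

text \<open>
  Along one point of \<open>X\<close> the change of phase under \<open>f\<close> is constant, because phases grow by one per cell in the
  point and in its image alike.  The change depends only on a word of length \<open>2 * r + m\<close>, and by
  transitivity any two such words occur in a common point, so the constant is the same for all points.
\<close>

lemma phase_drift:
  fixes p :: int and \<theta> :: "'a list \<Rightarrow> int"
  assumes \<theta>: "\<And>u d v. reach u d v \<Longrightarrow> 0 \<le> d \<Longrightarrow> p dvd \<theta> v - \<theta> u - d"
  obtains c where "\<And>y i. y \<in> configs B \<Longrightarrow> word y (i - r) (nat (2 * r) + m) \<in> lang X \<Longrightarrow>
    p dvd \<theta> (word (f y) i m) - \<theta> (word y i m) - c"
proof -
  define L where "L = nat (2 * r) + m"
  have L: "int L = 2 * r + int m" using radius by (simp add: L_def)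
  define g where "g y i = \<theta> (word (f y) i m) - \<theta> (word y i m)" for y i
  have g_local: "g x i = g y j" if "x \<in> configs B" "y \<in> configs B" "word x (i - r) L = word y (j - r) L" for x y i j
  proof -
    have e: "x (i + t) = y (j + t)" if "- r \<le> t" "t < int m + r" for t
      using \<open>word x (i - r) L = word y (j - r) L\<close>[unfolded word_eq_iff, rule_format, of "t + r"] that L
      by (simp add: algebra_simps)
    have "word x i m = word y j m" unfolding word_eq_iff using e radius by simp
    moreover have "word (f x) i m = word (f y) j m"
      using word_iterate[OF that(1,2), of 1 m i j] e by simp
    ultimately show ?thesis by (simp add: g_def)
  qed
  have along: "p dvd g x j - g x i" if x: "x \<in> X" "i \<le> j" for x i j
  proof -
    have *: "p dvd \<theta> (word y j m) - \<theta> (word y i m) - (j - i)" if "y \<in> X" for y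
      using \<theta>[OF reach_within[OF that, of i "j - i"]] x(2) by simp
    have "p dvd (\<theta> (word (f x) j m) - \<theta> (word (f x) i m) - (j - i)) - (\<theta> (word x j m) - \<theta> (word x i m) - (j - i))"
      by (rule dvd_diff[OF *[OF X_invariant[OF x(1)]] *[OF x(1)]])
    then show ?thesis by (simp add: g_def algebra_simps)
  qed
  obtain x0 where x0: "x0 \<in> X" using nonempty by blast
  have const: "p dvd g x r - g x0 r" if x: "x \<in> X" for x
  proof -
    obtain w where "word x0 0 L @ w @ word x 0 L \<in> lang X"
      using trans word_in_lang[OF x0] word_in_lang[OF x] unfolding transitive_shift_def by blast
    then obtain z where z: "z \<in> X" "word z 0 (L + (length w + L)) = word x0 0 L @ w @ word x 0 L"
      by (auto simp: lang_iff)
    define s where "s = int L + int (length w)"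
    have zw: "word z 0 L = word x0 0 L" "word z s L = word x 0 L"
      using z(2) unfolding word_append by (auto simp: s_def)
    have "g z r = g x0 r"
      by (rule g_local) (use z x0 X_configs zw in simp_all)
    moreover have "g z (s + r) = g x r"
      by (rule g_local) (use z x X_configs zw in simp_all)
    ultimately show ?thesis using along[OF z(1), of r "s + r"] by (simp add: s_def)
  qed
  show thesis
  proof (rule that[of "g x0 r"])
    fix y i assume y: "y \<in> configs B" "word y (i - r) (nat (2 * r) + m) \<in> lang X"
    then obtain x where x: "x \<in> X" "word x 0 L = word y (i - r) L"
      unfolding lang_iff L_def by auto
    have "g y i = g x r" by (rule g_local) (use y x X_configs in simp_all)
    then have "p dvd g y i - g x0 r" using const[OF x(1)] by simp
    then show "p dvd \<theta> (word (f y) i m) - \<theta> (word y i m) - g x0 r" by (simp add: g_def)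
  qed
qed

text \<open>
  The radius \<open>R\<close> is enlarged so that agreement with \<open>x0\<close> on \<open>[-R, R]\<close> fixes the window at the origin at time
  \<open>N\<close>; from then on the phase there is known for ever.  Comparing two copies of this pattern at the
  distances \<open>2 * R + 1\<close> and \<open>2 * R + 2\<close> shows that the period divides two consecutive integers.
\<close>

theorem generic_limit_mixing: "mixing_shift X"
proof -
  obtain p \<theta> where p: "0 < p" and \<theta>: "\<And>u d v. reach u d v \<Longrightarrow> 0 \<le> d \<Longrightarrow> p dvd \<theta> v - \<theta> u - d"
    and mix: "p = 1 \<Longrightarrow> mixing_shift X"
    by (rule phase_exists[OF trans nonempty]) (rule that)
  obtain c where c: "\<And>y i. y \<in> configs B \<Longrightarrow> word y (i - r) (nat (2 * r) + m) \<in> lang X \<Longrightarrow>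
    p dvd \<theta> (word (f y) i m) - \<theta> (word y i m) - c"
    by (rule phase_drift[of p \<theta>], rule \<theta>, assumption+, rule that)
  obtain x0 N R0 where x0: "x0 \<in> configs B" and R0: "\<And>x k. x \<in> configs B \<Longrightarrow>
      \<forall>t. \<bar>t\<bar> \<le> int R0 \<longrightarrow> x t = x0 t \<Longrightarrow> N \<le> k \<Longrightarrow> word ((f ^^ k) x) (- r) (nat (2 * r) + m) \<in> lang X"
    by (rule settling_cylinder[where i = "- r" and n = "nat (2 * r) + m"]) (rule that)
  define R where "R = int R0 + int N * r + int m"
  have R: "int R0 \<le> R" "int N * r + int m \<le> R" "0 \<le> R" using radius by (simp_all add: R_def)
  define a where "a = \<theta> (word ((f ^^ N) x0) 0 m)"
  have phase: "p dvd \<theta> (word ((f ^^ (N + k)) x) j m) - a - int k * c"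
    if x: "x \<in> configs B" "\<And>t. \<bar>t\<bar> \<le> R \<Longrightarrow> x (j + t) = x0 t" for x j k
  proof (induction k)
    case 0
    have "word ((f ^^ N) x) j m = word ((f ^^ N) x0) 0 m"
    proof (rule word_iterate[OF x(1) x0])
      fix t assume "- (int N * r) \<le> t" "t < int m + int N * r"
      then show "x (j + t) = x0 (0 + t)" using x(2)[of t] R(2) by simp
    qed
    then show ?case by (simp add: a_def)
  next
    case (Suc k)
    let ?y = "(f ^^ (N + k)) x"
    have y: "?y \<in> configs B" by (rule iterate_closed[OF x(1)])
    have x': "(\<lambda>t. x (t + j)) \<in> configs B" using x(1) by (simp add: configs_iff)
    have "word ((f ^^ (N + k)) (\<lambda>t. x (t + j))) (- r) (nat (2 * r) + m) \<in> lang X"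
    proof (rule R0[OF x'], intro allI impI)
      fix t assume "\<bar>t\<bar> \<le> int R0"
      then show "x (t + j) = x0 t" using x(2)[of t] R(1) by (simp add: add.commute)
    qed simp
    moreover have "word ((f ^^ (N + k)) (\<lambda>t. x (t + j))) (- r) (nat (2 * r) + m) = word ?y (j - r) (nat (2 * r) + m)"
      by (rule word_iterate[OF x' x(1)]) (simp add: algebra_simps)
    ultimately have "p dvd \<theta> (word (f ?y) j m) - \<theta> (word ?y j m) - c" using c[OF y] by simp
    from dvd_add[OF this Suc.IH] show ?case by (simp add: algebra_simps)
  qed
  have div: "p dvd j" if j: "2 * R + 1 \<le> j" for j
  proof -
    define y where "y t = (if t \<le> R then x0 t else x0 (t - j))" for t
    define U where "U = {x \<in> configs B. \<forall>t. \<bar>t\<bar> \<le> R + j \<longrightarrow> x t = y t}"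
    have y: "y \<in> configs B" using x0 by (simp add: y_def configs_iff)
    then have "U \<noteq> {}" unfolding U_def by blast
    moreover have "openin (config_top B) U"
      unfolding U_def by (rule clopen_of_local(1)[where R = "R + j"]) simp
    ultimately have "U \<inter> {x \<in> configs B. \<exists>N. \<forall>k\<ge>N. word ((f ^^ k) x) 0 (nat j + m) \<in> lang X} \<noteq> {}"
      using comeager_meets_open[OF finite_alphabet settles] by blast
    then obtain x M where x: "x \<in> configs B" "\<And>t. \<bar>t\<bar> \<le> R + j \<Longrightarrow> x t = y t"
      and M: "\<And>k. k \<ge> M \<Longrightarrow> word ((f ^^ k) x) 0 (nat j + m) \<in> lang X"
      unfolding U_def by blast
    let ?z = "(f ^^ (N + M)) x"
    have "word ?z 0 (nat j + m) \<in> lang X" by (rule M) simp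
    then obtain z where z: "z \<in> X" "word z 0 (nat j + m) = word ?z 0 (nat j + m)"
      unfolding lang_iff by auto
    have z1: "word z 0 m = word ?z 0 m" "word z j m = word ?z j m"
      using z(2) j R(3) unfolding word_eq_iff by (auto simp: algebra_simps)
    have 1: "p dvd \<theta> (word ?z j m) - \<theta> (word ?z 0 m) - j"
      using \<theta>[OF reach_within[OF z(1), of 0 j]] j R(3) z1 by simp
    have 2: "p dvd \<theta> (word ?z 0 m) - a - int M * c"
    proof (rule phase[OF x(1)])
      fix t assume "\<bar>t\<bar> \<le> R"
      then have "\<bar>0 + t\<bar> \<le> R + j" "t \<le> R" using j R(3) by linarith+
      then show "x (0 + t) = x0 t" using x(2)[of "0 + t"] by (simp add: y_def)
    qed
    have 3: "p dvd \<theta> (word ?z j m) - a - int M * c"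
    proof (rule phase[OF x(1)])
      fix t assume "\<bar>t\<bar> \<le> R"
      then have "\<bar>j + t\<bar> \<le> R + j" "\<not> j + t \<le> R" using j R(3) by linarith+
      then show "x (j + t) = x0 t" using x(2)[of "j + t"] by (simp add: y_def)
    qed
    have "p dvd ((\<theta> (word ?z j m) - a - int M * c) - (\<theta> (word ?z 0 m) - a - int M * c)) - (\<theta> (word ?z j m) - \<theta> (word ?z 0 m) - j)"
      by (rule dvd_diff[OF dvd_diff[OF 3 2] 1])
    then show ?thesis by simp
  qed
  have "p dvd (2 * R + 2) - (2 * R + 1)" by (rule dvd_diff) (rule div, simp)+
  then have "p = 1" using p by simp
  then show ?thesis by (rule mix)
qed

end

section \<open>A cellular automaton that repairs gaps\<close>

lemma last_satisfying:
  fixes a k :: int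
  assumes "P a" "a \<le> k"
  obtains l where "a \<le> l" "l \<le> k" "P l" "\<forall>i. l < i \<and> i \<le> k \<longrightarrow> \<not> P i"
proof -
  have "\<exists>l\<ge>a. l \<le> k \<and> P l \<and> (\<forall>i. l < i \<and> i \<le> k \<longrightarrow> \<not> P i)"
    using assms(2)
  proof (induction k rule: int_ge_induct)
    case base
    then show ?case using assms(1) by (intro exI[of _ a]) auto
  next
    case (step k)
    show ?case
    proof (cases "P (k + 1)")
      case True
      then show ?thesis using step.hyps by (intro exI[of _ "k + 1"]) auto
    next
      case False
      obtain l where l: "a \<le> l" "l \<le> k" "P l" "\<forall>i. l < i \<and> i \<le> k \<longrightarrow> \<not> P i"
        using step.IH by blast
      have "\<not> P i" if "l < i" "i \<le> k + 1" for i
        using l(4) False that by (cases "i = k + 1") auto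
      then show ?thesis using l by (intro exI[of _ l]) simp
    qed
  qed
  then show thesis using that by blast
qed

lemma first_satisfying:
  fixes b k :: int
  assumes "P b" "k \<le> b"
  obtains l where "k \<le> l" "l \<le> b" "P l" "\<forall>i. k \<le> i \<and> i < l \<longrightarrow> \<not> P i"
proof -
  have "P (- (- b))" "- b \<le> - k" using assms by auto
  then obtain l where l: "- b \<le> l" "l \<le> - k" "P (- l)" "\<forall>i. l < i \<and> i \<le> - k \<longrightarrow> \<not> P (- i)"
    by (rule last_satisfying[of "\<lambda>i. P (- i)"]) (rule that)
  have "\<forall>i. k \<le> i \<and> i < - l \<longrightarrow> \<not> P i"
  proof (intro allI impI)
    fix i assume "k \<le> i \<and> i < - l"
    then show "\<not> P i" using l(4)[rule_format, of "- i"] by simp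
  qed
  moreover have "k \<le> - l" "- l \<le> b" using l(1,2) by linarith+
  ultimately show thesis using that l(3) by blast
qed

text \<open>
  The constant \<open>N\<close> is both the distance from which on all windows can be connected and the margin in
  the definition of a core below.
\<close>

locale gap_repair = window_shift A X m for A :: "'a set" and X m +
  fixes N :: int
  assumes finite_A: "finite A" and nonempty: "X \<noteq> {}"
    and N_ge: "int m \<le> N"
    and connect: "u \<in> windows \<Longrightarrow> v \<in> windows \<Longrightarrow> N \<le> d \<Longrightarrow> reach u d v"
begin

definition valid :: "'a config \<Rightarrow> int \<Rightarrow> bool" where
  "valid x i \<longleftrightarrow> word x i m \<in> windows"

text \<open>
  A position deep inside a valid stretch.  The margin \<open>N\<close> guarantees that invalid windows keep cores apart, so
  that erasing everything between two cores always leaves room for a bridge.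
\<close>

definition core :: "'a config \<Rightarrow> int \<Rightarrow> bool" where
  "core x j \<longleftrightarrow> (\<forall>i. \<bar>i - j\<bar> \<le> N \<longrightarrow> valid x i)"

text \<open>
  The length up to which a gap is closed in a single step.  In a longer gap the zone of \<open>N + m\<close> cells rewritten
  after the left core and the zone of \<open>N\<close> cells rewritten before the right core do not overlap.
\<close>

definition G :: int where "G = 2 * N + int m"

definition point :: "'a list \<Rightarrow> 'a config" where
  "point u = (SOME y. y \<in> X \<and> word y 0 m = u)"

definition bridge :: "'a list \<Rightarrow> int \<Rightarrow> 'a list \<Rightarrow> 'a config" where
  "bridge u d v = (SOME y. y \<in> X \<and> word y 0 m = u \<and> word y d m = v)"

definition in_short_gap :: "'a config \<Rightarrow> int \<Rightarrow> int \<Rightarrow> int \<Rightarrow> bool" where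
  "in_short_gap x k s t \<longleftrightarrow> 0 < s \<and> 0 < t \<and> s + t \<le> G \<and> core x (k - s) \<and> core x (k + t) \<and>
     (\<forall>l. - s < l \<and> l < t \<longrightarrow> \<not> core x (k + l))"

definition right_of_core :: "'a config \<Rightarrow> int \<Rightarrow> int \<Rightarrow> bool" where
  "right_of_core x k s \<longleftrightarrow> 0 < s \<and> s \<le> N + int m \<and> core x (k - s) \<and>
     (\<forall>l. - s < l \<and> l \<le> 0 \<longrightarrow> \<not> core x (k + l))"

definition left_of_core :: "'a config \<Rightarrow> int \<Rightarrow> int \<Rightarrow> bool" where
  "left_of_core x k t \<longleftrightarrow> 0 < t \<and> t \<le> N \<and> core x (k + t) \<and>
     (\<forall>l. 0 \<le> l \<and> l < t \<longrightarrow> \<not> core x (k + l))"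

text \<open>
  Gaps are closed by bridges if short; otherwise each side of the gap is continued by a fixed point of \<open>X\<close>
  through the bordering core window.  The continuation to the right produces one valid window more than
  the margin \<open>N\<close>, which turns the next position into a core; to the left the margin is merely
  restored.  The positions of the cores enter as distances from the cell \<open>k\<close>, which makes the rule
  visibly shift-invariant; these distances are unique, so \<open>THE\<close> is well defined.
\<close>

definition repair :: "'a config \<Rightarrow> 'a config" where
  "repair x k =
    (if core x k then x k
     else if \<exists>s t. in_short_gap x k s t then
       (THE c. \<exists>s t. in_short_gap x k s t \<and> c = bridge (word x (k - s) m) (s + t) (word x (k + t) m) s)
     else if \<exists>s. right_of_core x k s then
       (THE c. \<exists>s. right_of_core x k s \<and> c = point (word x (k - s) m) s)
     else if \<exists>t. left_of_core x k t then
       (THE c. \<exists>t. left_of_core x k t \<and> c = point (word x (k + t) m) (- t))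
     else x k)"

lemma N_pos: "0 < N"
  using N_ge window_pos by simp

lemma point:
  assumes "u \<in> windows"
  shows "point u \<in> X \<and> word (point u) 0 m = u"
proof -
  have "\<exists>y. y \<in> X \<and> word y 0 m = u" using assms unfolding windows_def by blast
  from someI_ex[OF this] show ?thesis unfolding point_def .
qed

lemma bridge:
  assumes "u \<in> windows" "v \<in> windows" "N \<le> d"
  shows "bridge u d v \<in> X \<and> word (bridge u d v) 0 m = u \<and> word (bridge u d v) d m = v"
proof -
  have "\<exists>y. y \<in> X \<and> word y 0 m = u \<and> word y d m = v"
    using connect[OF assms] unfolding reach_def by blast
  from someI_ex[OF this] show ?thesis unfolding bridge_def .
qed

lemma core_valid: "core x j \<Longrightarrow> \<bar>i - j\<bar> \<le> N \<Longrightarrow> valid x i"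
  unfolding core_def by blast

lemma core_window: "core x j \<Longrightarrow> word x j m \<in> windows"
  using core_valid[of x j j] N_pos unfolding valid_def by simp

lemma in_short_gap_unique:
  assumes "in_short_gap x k s t" "in_short_gap x k s' t'"
  shows "s = s' \<and> t = t'"
proof -
  have *: "\<not> core x (k + l)" if "- s < l" "l < t" for l using assms(1) that by (simp add: in_short_gap_def)
  have free2: "\<not> core x (k + l)" if "- s' < l" "l < t'" for l using assms(2) that by (simp add: in_short_gap_def)
  have c: "core x (k + (- s))" "core x (k + t)" "core x (k + (- s'))" "core x (k + t')"
    and p: "0 < s" "0 < t" "0 < s'" "0 < t'"
    using assms by (simp_all add: in_short_gap_def)
  have "\<not> s < s'" using free2[of "- s"] c p by auto
  moreover have "\<not> s' < s" using *[of "- s'"] c p by auto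
  moreover have "\<not> t < t'" using free2[of t] c p by auto
  moreover have "\<not> t' < t" using *[of t'] c p by auto
  ultimately show ?thesis by simp
qed

lemma right_of_core_unique:
  assumes "right_of_core x k s" "right_of_core x k s'"
  shows "s = s'"
proof -
  have free: "\<not> core x (k + l)" if "- s < l" "l \<le> 0" for l
    using assms(1) that by (simp add: right_of_core_def)
  have free2: "\<not> core x (k + l)" if "- s' < l" "l \<le> 0" for l
    using assms(2) that by (simp add: right_of_core_def)
  have c: "core x (k + (- s))" "core x (k + (- s'))" and p: "0 < s" "0 < s'"
    using assms by (simp_all add: right_of_core_def)
  show ?thesis using free[of "- s'"] free2[of "- s"] c p by fastforce
qed

lemma left_of_core_unique:
  assumes "left_of_core x k t" "left_of_core x k t'"
  shows "t = t'"
proof -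
  have free: "\<not> core x (k + l)" if "0 \<le> l" "l < t" for l
    using assms(1) that by (simp add: left_of_core_def)
  have free2: "\<not> core x (k + l)" if "0 \<le> l" "l < t'" for l
    using assms(2) that by (simp add: left_of_core_def)
  have c: "core x (k + t)" "core x (k + t')" and p: "0 < t" "0 < t'"
    using assms by (simp_all add: left_of_core_def)
  show ?thesis using free[of t'] free2[of t] c p by fastforce
qed

lemma repair_core: "core x k \<Longrightarrow> repair x k = x k"
  by (simp add: repair_def)

lemma in_short_gap_not_core:
  assumes "in_short_gap x k s t"
  shows "\<not> core x k"
proof -
  have "0 < s" "0 < t" "\<forall>l. - s < l \<and> l < t \<longrightarrow> \<not> core x (k + l)"
    using assms by (simp_all add: in_short_gap_def)
  from this(3)[rule_format, of 0] this(1,2) show ?thesis by simp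
qed

lemma right_of_core_not_core:
  assumes "right_of_core x k s"
  shows "\<not> core x k"
proof -
  have "0 < s" "\<forall>l. - s < l \<and> l \<le> 0 \<longrightarrow> \<not> core x (k + l)"
    using assms by (simp_all add: right_of_core_def)
  from this(2)[rule_format, of 0] this(1) show ?thesis by simp
qed

lemma left_of_core_not_core:
  assumes "left_of_core x k t"
  shows "\<not> core x k"
proof -
  have "0 < t" "\<forall>l. 0 \<le> l \<and> l < t \<longrightarrow> \<not> core x (k + l)"
    using assms by (simp_all add: left_of_core_def)
  from this(2)[rule_format, of 0] this(1) show ?thesis by simp
qed

lemma repair_in_short_gap:
  assumes "in_short_gap x k s t"
  shows "repair x k = bridge (word x (k - s) m) (s + t) (word x (k + t) m) s"
proof -
  have "(THE c. \<exists>s t. in_short_gap x k s t \<and> c = bridge (word x (k - s) m) (s + t) (word x (k + t) m) s)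
     = bridge (word x (k - s) m) (s + t) (word x (k + t) m) s"
  proof (rule the_equality)
    fix c assume "\<exists>s t. in_short_gap x k s t \<and> c = bridge (word x (k - s) m) (s + t) (word x (k + t) m) s"
    then obtain s' t' where st: "in_short_gap x k s' t'"
      "c = bridge (word x (k - s') m) (s' + t') (word x (k + t') m) s'" by blast
    have "s = s' \<and> t = t'" by (rule in_short_gap_unique[OF assms st(1)])
    then show "c = bridge (word x (k - s) m) (s + t) (word x (k + t) m) s" using st(2) by simp
  qed (use assms in blast)
  moreover have "\<exists>s t. in_short_gap x k s t" using assms by blast
  ultimately show ?thesis by (simp only: repair_def if_not_P[OF in_short_gap_not_core[OF assms]] if_P)
qed

lemma repair_right_of_core:
  assumes "right_of_core x k s" "\<not> (\<exists>s t. in_short_gap x k s t)"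
  shows "repair x k = point (word x (k - s) m) s"
proof -
  have "(THE c. \<exists>s. right_of_core x k s \<and> c = point (word x (k - s) m) s) = point (word x (k - s) m) s"
  proof (rule the_equality)
    fix c assume "\<exists>s. right_of_core x k s \<and> c = point (word x (k - s) m) s"
    then show "c = point (word x (k - s) m) s" using right_of_core_unique[OF assms(1)] by auto
  qed (use assms in blast)
  moreover have "\<exists>s. right_of_core x k s" using assms by blast
  ultimately show ?thesis
    by (simp only: repair_def if_not_P[OF right_of_core_not_core[OF assms(1)]] if_not_P[OF assms(2)] if_P)
qed

lemma repair_left_of_core:
  assumes "left_of_core x k t" "\<not> (\<exists>s t. in_short_gap x k s t)" "\<not> (\<exists>s. right_of_core x k s)"
  shows "repair x k = point (word x (k + t) m) (- t)"
proof -
  have "(THE c. \<exists>t. left_of_core x k t \<and> c = point (word x (k + t) m) (- t)) = point (word x (k + t) m) (- t)"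
  proof (rule the_equality)
    fix c assume "\<exists>t. left_of_core x k t \<and> c = point (word x (k + t) m) (- t)"
    then show "c = point (word x (k + t) m) (- t)" using left_of_core_unique[OF assms(1)] by auto
  qed (use assms in blast)
  moreover have "\<exists>t. left_of_core x k t" using assms by blast
  ultimately show ?thesis
    by (simp only: repair_def if_not_P[OF left_of_core_not_core[OF assms(1)]] if_not_P[OF assms(2)]
        if_not_P[OF assms(3)] if_P)
qed

lemma repair_other:
  assumes "\<not> (\<exists>s t. in_short_gap x k s t)" "\<not> (\<exists>s. right_of_core x k s)" "\<not> (\<exists>t. left_of_core x k t)"
  shows "repair x k = x k"
  by (simp only: repair_def if_not_P[OF assms(1)] if_not_P[OF assms(2)] if_not_P[OF assms(3)] if_cancel)

definition consecutive :: "'a config \<Rightarrow> int \<Rightarrow> int \<Rightarrow> bool" where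
  "consecutive x a b \<longleftrightarrow> a < b \<and> core x a \<and> core x b \<and> (\<forall>l. a < l \<and> l < b \<longrightarrow> \<not> core x l)"

text \<open>
  The position after \<open>a\<close> fails to be a core, but all windows within \<open>N\<close> of \<open>a\<close> are valid, so the
  invalid window is exactly the one at \<open>a + 1 + N\<close>.  It is more than \<open>N\<close> away from \<open>b\<close>.
\<close>

lemma gap_wide:
  assumes c: "consecutive x a b" and ne: "b \<noteq> a + 1"
  shows "N \<le> b - a"
proof -
  have ab: "a + 1 < b" "core x a" "core x b" using c ne by (auto simp: consecutive_def)
  then have "\<not> core x (a + 1)" using c by (simp add: consecutive_def)
  then obtain i where i: "\<bar>i - (a + 1)\<bar> \<le> N" "\<not> valid x i" unfolding core_def by blast
  have "\<not> \<bar>i - a\<bar> \<le> N" "\<not> \<bar>i - b\<bar> \<le> N" using core_valid ab i(2) by blast+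
  then show ?thesis using i(1) ab(1) by linarith
qed

lemma in_short_gap_consecutive:
  "in_short_gap x k s t \<longleftrightarrow> consecutive x (k - s) (k + t) \<and> 0 < s \<and> 0 < t \<and> s + t \<le> G"
proof
  assume A: "in_short_gap x k s t"
  then have free: "\<forall>l. - s < l \<and> l < t \<longrightarrow> \<not> core x (k + l)" by (simp add: in_short_gap_def)
  have "\<not> core x l" if "k - s < l" "l < k + t" for l
    using free[rule_format, of "l - k"] that by simp
  then show "consecutive x (k - s) (k + t) \<and> 0 < s \<and> 0 < t \<and> s + t \<le> G"
    using A unfolding in_short_gap_def consecutive_def by auto
next
  assume A: "consecutive x (k - s) (k + t) \<and> 0 < s \<and> 0 < t \<and> s + t \<le> G"
  then show "in_short_gap x k s t" unfolding in_short_gap_def consecutive_def by auto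
qed

lemma repair_fill:
  assumes c: "consecutive x a b" and G: "b - a \<le> G" and k: "a < k" "k < b"
  shows "repair x k = bridge (word x a m) (b - a) (word x b m) (k - a)"
proof -
  have "in_short_gap x k (k - a) (b - k)" unfolding in_short_gap_consecutive using assms by simp
  from repair_in_short_gap[OF this] show ?thesis by simp
qed

lemma repair_extend_right:
  assumes a: "core x a" and free: "\<And>l. a < l \<Longrightarrow> l \<le> a + G \<Longrightarrow> \<not> core x l"
    and k: "a < k" "k \<le> a + N + int m"
  shows "repair x k = point (word x a m) (k - a)"
proof -
  have kG: "k \<le> a + G" using k N_pos by (simp add: G_def)
  have "right_of_core x k (k - a)" unfolding right_of_core_def using a k free kG by auto
  moreover have "\<not> (\<exists>s t. in_short_gap x k s t)"
  proof
    assume "\<exists>s t. in_short_gap x k s t"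
    then obtain s t where st: "consecutive x (k - s) (k + t)" "0 < s" "0 < t" "s + t \<le> G"
      unfolding in_short_gap_consecutive by blast
    have "\<not> k - s < a" using st(1) a k st(3) unfolding consecutive_def by auto
    moreover have "core x (k - s)" "core x (k + t)" using st(1) unfolding consecutive_def by auto
    then have "\<not> a < k - s" using free[of "k - s"] st(2) kG by auto
    ultimately have "k - s = a" by simp
    then have "\<not> core x (k + t)" using k st by (intro free) auto
    with \<open>core x (k + t)\<close> show False by simp
  qed
  ultimately have "repair x k = point (word x (k - (k - a)) m) (k - a)" by (rule repair_right_of_core)
  then show ?thesis by simp
qed

lemma repair_extend_left:
  assumes b: "core x b" and free: "\<And>l. b - G \<le> l \<Longrightarrow> l < b \<Longrightarrow> \<not> core x l"
    and k: "b - N \<le> k" "k < b"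
  shows "repair x k = point (word x b m) (k - b)"
proof -
  have kG: "b - G \<le> k" using k N_pos by (simp add: G_def)
  have "left_of_core x k (b - k)" unfolding left_of_core_def using b k free kG by auto
  moreover have "\<not> (\<exists>s t. in_short_gap x k s t)"
  proof
    assume "\<exists>s t. in_short_gap x k s t"
    then obtain s t where st: "consecutive x (k - s) (k + t)" "0 < s" "0 < t" "s + t \<le> G"
      unfolding in_short_gap_consecutive by blast
    have "\<not> b < k + t" using st(1) b k st(2) unfolding consecutive_def by auto
    moreover have "core x (k - s)" "core x (k + t)" using st(1) unfolding consecutive_def by auto
    then have "\<not> k + t < b" using free[of "k + t"] st(3) kG by auto
    ultimately have "k + t = b" by simp
    then have "\<not> core x (k - s)" using k st by (intro free) auto
    with \<open>core x (k - s)\<close> show False by simp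
  qed
  moreover have "\<not> (\<exists>s. right_of_core x k s)"
  proof
    assume "\<exists>s. right_of_core x k s"
    then obtain s where s: "0 < s" "s \<le> N + int m" "core x (k - s)" unfolding right_of_core_def by blast
    have "\<not> core x (k - s)" by (rule free) (use s k in \<open>auto simp: G_def\<close>)
    with s show False by simp
  qed
  ultimately have "repair x k = point (word x (k + (b - k)) m) (- (b - k))" by (rule repair_left_of_core)
  then show ?thesis by simp
qed

lemma next_core:
  assumes "core x a"
  obtains (near) b where "consecutive x a b" "b - a \<le> G"
    | (far) "\<And>l. a < l \<Longrightarrow> l \<le> a + G \<Longrightarrow> \<not> core x l"
proof (cases "\<exists>l. a < l \<and> l \<le> a + G \<and> core x l")
  case True
  then obtain l where l: "a < l" "l \<le> a + G" "core x l" by blast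
  then have "a + 1 \<le> l" by simp
  with l(3) obtain b where b: "a + 1 \<le> b" "b \<le> l" "core x b" "\<forall>i. a + 1 \<le> i \<and> i < b \<longrightarrow> \<not> core x i"
    by (rule first_satisfying[of "core x"]) (rule that)
  then have "consecutive x a b" using assms unfolding consecutive_def by simp
  then show thesis using b l by (intro near) auto
qed (use far in blast)

lemma previous_core:
  assumes "core x b"
  obtains (near) a where "consecutive x a b" "b - a \<le> G"
    | (far) "\<And>l. b - G \<le> l \<Longrightarrow> l < b \<Longrightarrow> \<not> core x l"
proof (cases "\<exists>l. b - G \<le> l \<and> l < b \<and> core x l")
  case True
  then obtain l where l: "b - G \<le> l" "l < b" "core x l" by blast
  then have "l \<le> b - 1" by simp
  with l(3) obtain a where a: "l \<le> a" "a \<le> b - 1" "core x a" "\<forall>i. a < i \<and> i \<le> b - 1 \<longrightarrow> \<not> core x i"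
    by (rule last_satisfying[of "core x"]) (rule that)
  then have "consecutive x a b" using assms unfolding consecutive_def by simp
  then show thesis using a l by (intro near) auto
qed (use far in blast)

text \<open>
  A core cell keeps its symbol, but its window of length \<open>m\<close> may stick out into a gap.  The part in the gap is
  rewritten by a bridge or a continuation that starts with the same core window, hence with the same
  symbols.
\<close>

lemma repair_core_word:
  assumes j: "core x j"
  shows "word (repair x) j m = word x j m"
  unfolding word_eq_iff
proof (intro allI impI)
  fix t :: int assume t: "0 \<le> t \<and> t < int m"
  define k where "k = j + t"
  obtain a where a: "j \<le> a" "a \<le> k" "core x a" "\<forall>i. a < i \<and> i \<le> k \<longrightarrow> \<not> core x i"
    using last_satisfying[of "core x" j k] j t unfolding k_def by auto
  have ka: "0 \<le> k - a" "k - a < int m" using a t by (auto simp: k_def)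
  have "repair x k = x k"
  proof (cases "k = a")
    case True
    then show ?thesis using repair_core a by simp
  next
    case False
    then have "a < k" using a by simp
    have aw: "word x a m \<in> windows" using core_window a by simp
    from a(3) show ?thesis
    proof (cases rule: next_core)
      case (near b)
      have kb: "k < b" using near(1) a(4) \<open>a < k\<close> unfolding consecutive_def by auto
      have "N \<le> b - a" using gap_wide[OF near(1)] kb \<open>a < k\<close> by auto
      moreover have "word x b m \<in> windows" using near(1) core_window unfolding consecutive_def by simp
      ultimately have "word (bridge (word x a m) (b - a) (word x b m)) 0 m = word x a m"
        using bridge aw by blast
      then have "bridge (word x a m) (b - a) (word x b m) (0 + (k - a)) = x (a + (k - a))"
        unfolding word_eq_iff using ka by blast
      then show ?thesis using repair_fill[OF near \<open>a < k\<close> kb] by simp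
    next
      case far
      have "repair x k = point (word x a m) (k - a)"
        by (rule repair_extend_right[OF a(3) far \<open>a < k\<close>]) (use ka N_pos in auto)
      moreover have "word (point (word x a m)) 0 m = word x a m" using point[OF aw] by blast
      then have "point (word x a m) (0 + (k - a)) = x (a + (k - a))"
        unfolding word_eq_iff using ka by blast
      ultimately show ?thesis by simp
    qed
  qed
  then show "repair x (j + t) = x (j + t)" by (simp add: k_def)
qed

lemma repair_core_letter:
  assumes "core x j" "j \<le> k" "k < j + int m"
  shows "repair x k = x k"
  using repair_core_word[OF assms(1), unfolded word_eq_iff, rule_format, of "k - j"] assms(2,3) by simp

lemma valid_of_word:
  assumes "y \<in> X" "\<And>t. 0 \<le> t \<Longrightarrow> t < int m \<Longrightarrow> z (i + t) = y (j + t)"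
  shows "valid z i"
proof -
  have "word z i m = word y j m" unfolding word_eq_iff using assms(2) by blast
  then show ?thesis unfolding valid_def using word_in_windows[OF assms(1)] by simp
qed

lemma valid_fill:
  assumes c: "consecutive x a b" and G: "b - a \<le> G" and i: "a \<le> i" "i \<le> b"
  shows "valid (repair x) i"
proof (cases "core x i")
  case True
  then show ?thesis unfolding valid_def using repair_core_word core_window by simp
next
  case False
  have ab: "core x a" "core x b" "a < b" using c by (auto simp: consecutive_def)
  then have ne: "a \<noteq> i" "i \<noteq> b" using False by auto
  let ?y = "bridge (word x a m) (b - a) (word x b m)"
  have "N \<le> b - a" by (rule gap_wide[OF c]) (use i ne in auto)
  then have y: "?y \<in> X" "word ?y 0 m = word x a m" "word ?y (b - a) m = word x b m"
    using bridge core_window ab by blast+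
  show ?thesis
  proof (rule valid_of_word[OF y(1)])
    fix t assume t: "0 \<le> t" "t < int m"
    show "repair x (i + t) = ?y (i - a + t)"
    proof (cases "i + t < b")
      case True
      have "repair x (i + t) = ?y (i + t - a)" by (rule repair_fill[OF c G]) (use True i ne t in auto)
      then show ?thesis by (simp add: algebra_simps)
    next
      case False
      then have "repair x (i + t) = x (i + t)" by (intro repair_core_letter[OF ab(2)]) (use i t in auto)
      moreover have "?y (b - a + (i + t - b)) = x (b + (i + t - b))"
        using y(3)[unfolded word_eq_iff, rule_format, of "i + t - b"] False i t by simp
      ultimately show ?thesis by (simp add: algebra_simps)
    qed
  qed
qed

lemma valid_extend_right:
  assumes a: "core x a" and free: "\<And>l. a < l \<Longrightarrow> l \<le> a + G \<Longrightarrow> \<not> core x l"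
    and i: "a < i" "i \<le> a + N + 1"
  shows "valid (repair x) i"
proof (rule valid_of_word)
  show "point (word x a m) \<in> X" using point core_window[OF a] by blast
  fix t assume t: "0 \<le> t" "t < int m"
  have "repair x (i + t) = point (word x a m) (i + t - a)"
    by (rule repair_extend_right[OF a free]) (use i t in auto)
  then show "repair x (i + t) = point (word x a m) (i - a + t)" by (simp add: algebra_simps)
qed

lemma valid_extend_left:
  assumes b: "core x b" and free: "\<And>l. b - G \<le> l \<Longrightarrow> l < b \<Longrightarrow> \<not> core x l"
    and i: "b - N \<le> i" "i < b"
  shows "valid (repair x) i"
proof (rule valid_of_word)
  have y: "point (word x b m) \<in> X" "word (point (word x b m)) 0 m = word x b m"
    using point core_window[OF b] by blast+
  then show "point (word x b m) \<in> X" by simp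
  fix t assume t: "0 \<le> t" "t < int m"
  show "repair x (i + t) = point (word x b m) (i - b + t)"
  proof (cases "i + t < b")
    case True
    have "repair x (i + t) = point (word x b m) (i + t - b)"
      by (rule repair_extend_left[OF b free]) (use True i t in auto)
    then show ?thesis by (simp add: algebra_simps)
  next
    case False
    then have "repair x (i + t) = x (i + t)" by (intro repair_core_letter[OF b]) (use i t in auto)
    moreover have "point (word x b m) (0 + (i + t - b)) = x (b + (i + t - b))"
      using y(2)[unfolded word_eq_iff, rule_format, of "i + t - b"] False i t by simp
    ultimately show ?thesis by (simp add: algebra_simps)
  qed
qed

text \<open>
  Although the repair rewrites the surroundings of a core, they stay valid up to distance \<open>N\<close>: a position
  in a short gap is covered by the bridge, and one in a long gap by the continuation of the nearest core on
  its side.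
\<close>

lemma valid_near_core:
  assumes j: "core x j" and i: "\<bar>i - j\<bar> \<le> N"
  shows "valid (repair x) i"
proof (cases "core x i")
  case True
  then show ?thesis unfolding valid_def using repair_core_word core_window by simp
next
  case False
  show ?thesis
  proof (cases "j \<le> i")
    case True
    with j obtain a where a: "j \<le> a" "a \<le> i" "core x a" "\<forall>l. a < l \<and> l \<le> i \<longrightarrow> \<not> core x l"
      by (rule last_satisfying[of "core x"]) (rule that)
    have "a < i" using a False by (cases "a = i") auto
    from a(3) show ?thesis
    proof (cases rule: next_core)
      case (near b)
      then have "i < b" using a(4) unfolding consecutive_def by auto
      then show ?thesis using valid_fill[OF near] a(2) by simp
    next
      case far
      show ?thesis by (rule valid_extend_right[OF a(3) far \<open>a < i\<close>]) (use a i in auto)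
    qed
  next
    case False2: False
    then have "i \<le> j" by simp
    with j obtain b where b: "i \<le> b" "b \<le> j" "core x b" "\<forall>l. i \<le> l \<and> l < b \<longrightarrow> \<not> core x l"
      by (rule first_satisfying[of "core x"]) (rule that)
    have "i < b" using b False by (cases "b = i") auto
    from b(3) show ?thesis
    proof (cases rule: previous_core)
      case (near a)
      then have "a < i" using b(4) unfolding consecutive_def by auto
      then show ?thesis using valid_fill[OF near] b(1) by simp
    next
      case far
      show ?thesis by (rule valid_extend_left[OF b(3) far _ \<open>i < b\<close>]) (use b i in auto)
    qed
  qed
qed

lemma core_persists: "core x j \<Longrightarrow> core (repair x) j"
  unfolding core_def[of "repair x"] using valid_near_core by blast

lemma core_fill:
  assumes c: "consecutive x a b" "b - a \<le> G" and k: "a \<le> k" "k \<le> b"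
  shows "core (repair x) k"
  unfolding core_def
proof (intro allI impI)
  fix i assume i: "\<bar>i - k\<bar> \<le> N"
  have ab: "core x a" "core x b" using c(1) by (auto simp: consecutive_def)
  consider "i < a" | "a \<le> i" "i \<le> b" | "b < i" by linarith
  then show "valid (repair x) i"
  proof cases
    case 1
    then show ?thesis by (intro valid_near_core[OF ab(1)]) (use i k in linarith)
  next
    case 2
    then show ?thesis using valid_fill[OF c] by simp
  next
    case 3
    then show ?thesis by (intro valid_near_core[OF ab(2)]) (use i k in linarith)
  qed
qed

text \<open>
  The only window that the core \<open>a + 1\<close> needs beyond those within \<open>N\<close> of \<open>a\<close> is the one at \<open>a + N + 1\<close>,
  the last one produced by the continuation to the right.
\<close>

lemma core_grows:
  assumes a: "core x a" and free: "\<And>l. a < l \<Longrightarrow> l \<le> a + G \<Longrightarrow> \<not> core x l"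
  shows "core (repair x) (a + 1)"
  unfolding core_def
proof (intro allI impI)
  fix i assume i: "\<bar>i - (a + 1)\<bar> \<le> N"
  show "valid (repair x) i"
  proof (cases "a < i")
    case True
    then show ?thesis by (intro valid_extend_right[OF a free]) (use i in auto)
  next
    case False
    then show ?thesis by (intro valid_near_core[OF a]) (use i in auto)
  qed
qed

lemma core_persists_iterate:
  "core x k \<Longrightarrow> core ((repair ^^ n) x) k \<and> (repair ^^ n) x k = x k"
  by (induction n) (auto simp: core_persists repair_core)

text \<open>
  In each step the first gap to the right of \<open>a\<close> is closed or shortened, so the interval in which
  non-cores remain shrinks from the left.
\<close>

lemma cores_fill_up:
  "core x a \<Longrightarrow> core x b \<Longrightarrow> a \<le> b \<Longrightarrow> \<exists>n. \<forall>k. a \<le> k \<and> k \<le> b \<longrightarrow> core ((repair ^^ n) x) k"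
proof (induction "nat (b - a)" arbitrary: x a rule: less_induct)
  case less
  show ?case
  proof (cases "a = b")
    case True
    then have "\<forall>k. a \<le> k \<and> k \<le> b \<longrightarrow> core ((repair ^^ 0) x) k" using less.prems by auto
    then show ?thesis by blast
  next
    case False
    then have ab: "a < b" using less.prems by simp
    have "\<exists>c. a < c \<and> c \<le> b \<and> (\<forall>k. a \<le> k \<and> k \<le> c \<longrightarrow> core (repair x) k)"
      using less.prems(1)
    proof (cases rule: next_core)
      case (near c)
      then have "c \<le> b" using ab less.prems(2) unfolding consecutive_def by (meson not_le)
      then show ?thesis using near core_fill[OF near] unfolding consecutive_def by blast
    next
      case far
      have "core (repair x) k" if "a \<le> k \<and> k \<le> a + 1" for k
      proof -
        have "k = a \<or> k = a + 1" using that by linarith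
        then show ?thesis using core_persists[OF less.prems(1)] core_grows[OF less.prems(1) far] by blast
      qed
      then show ?thesis using ab by (intro exI[of _ "a + 1"]) simp
    qed
    then obtain c where c: "a < c" "c \<le> b" "\<And>k. a \<le> k \<Longrightarrow> k \<le> c \<Longrightarrow> core (repair x) k" by blast
    obtain n where n: "\<forall>k. c \<le> k \<and> k \<le> b \<longrightarrow> core ((repair ^^ n) (repair x)) k"
      using less.hyps[of c "repair x"] c core_persists[OF less.prems(2)] by auto
    have "core ((repair ^^ Suc n) x) k" if "a \<le> k \<and> k \<le> b" for k
    proof (cases "c \<le> k")
      case True
      then show ?thesis using n that by (simp add: funpow_swap1)
    next
      case False
      then have "core (repair x) k" using c(3) that by simp
      then have "core ((repair ^^ n) (repair x)) k" using core_persists_iterate by blast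
      then show ?thesis by (simp add: funpow_swap1)
    qed
    then show ?thesis by blast
  qed
qed

end

section \<open>Mixing subshifts of finite type as generic limit sets\<close>

context gap_repair begin

lemma X_letter: "y \<in> X \<Longrightarrow> y k \<in> A"
  using sub_configs unfolding configs_iff[symmetric] by (meson configs_iff subsetD)

lemma repair_configs:
  assumes x: "x \<in> configs A"
  shows "repair x \<in> configs A"
  unfolding configs_iff
proof
  fix k
  consider (short) s t where "in_short_gap x k s t"
    | (right) s where "right_of_core x k s" "\<not> (\<exists>s t. in_short_gap x k s t)"
    | (left) t where "left_of_core x k t" "\<not> (\<exists>s t. in_short_gap x k s t)" "\<not> (\<exists>s. right_of_core x k s)"
    | (other) "\<not> (\<exists>s t. in_short_gap x k s t)" "\<not> (\<exists>s. right_of_core x k s)" "\<not> (\<exists>t. left_of_core x k t)"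
    by blast
  then show "repair x k \<in> A"
  proof cases
    case short
    then have c: "consecutive x (k - s) (k + t)" "0 < s" "0 < t" "core x (k - s)" "core x (k + t)"
      unfolding in_short_gap_consecutive consecutive_def by auto
    have "N \<le> (k + t) - (k - s)" by (rule gap_wide[OF c(1)]) (use c in simp)
    then have "bridge (word x (k - s) m) (s + t) (word x (k + t) m) \<in> X"
      using bridge[OF core_window[OF c(4)] core_window[OF c(5)], of "s + t"] by simp
    then show ?thesis using X_letter repair_in_short_gap[OF short] by simp
  next
    case right
    then have "core x (k - s)" by (simp add: right_of_core_def)
    then have "point (word x (k - s) m) \<in> X" using point[OF core_window] by blast
    then show ?thesis using X_letter repair_right_of_core[OF right] by simp
  next
    case left
    then have "core x (k + t)" by (simp add: left_of_core_def)
    then have "point (word x (k + t) m) \<in> X" using point[OF core_window] by blast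
    then show ?thesis using X_letter repair_left_of_core[OF left] by simp
  next
    case other
    then show ?thesis using repair_other[OF other] x by (simp add: configs_iff)
  qed
qed

lemma core_local:
  assumes "\<And>t. - N \<le> t \<Longrightarrow> t < N + int m \<Longrightarrow> x (i + t) = y (j + t)"
  shows "core x i = core y j"
proof -
  have w: "word x (i + l) m = word y (j + l) m" if "\<bar>l\<bar> \<le> N" for l
    unfolding word_eq_iff
  proof (intro allI impI)
    fix t assume "0 \<le> t \<and> t < int m"
    then have "x (i + (l + t)) = y (j + (l + t))" using that by (intro assms) linarith+
    then show "x (i + l + t) = y (j + l + t)" by (simp add: add.assoc)
  qed
  have core_alt: "core z k \<longleftrightarrow> (\<forall>l. \<bar>l\<bar> \<le> N \<longrightarrow> word z (k + l) m \<in> windows)" for z k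
  proof
    assume "core z k"
    then show "\<forall>l. \<bar>l\<bar> \<le> N \<longrightarrow> word z (k + l) m \<in> windows" unfolding core_def valid_def by simp
  next
    assume *: "\<forall>l. \<bar>l\<bar> \<le> N \<longrightarrow> word z (k + l) m \<in> windows"
    have "word z i m \<in> windows" if "\<bar>i - k\<bar> \<le> N" for i using *[rule_format, OF that] by simp
    then show "core z k" unfolding core_def valid_def by blast
  qed
  show ?thesis unfolding core_alt using w by simp
qed

text \<open>
  All distances in the rule are at most \<open>G\<close>, and deciding whether a position is a core requires another
  \<open>N + m\<close> cells.
\<close>

lemma repair_local:
  assumes e: "\<And>t. \<bar>t\<bar> \<le> G + N + int m \<Longrightarrow> x (i + t) = y (j + t)"
  shows "repair x i = repair y j"
proof -
  have NG: "N + int m \<le> G" "N \<le> G" using N_pos by (simp_all add: G_def)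
  have core_eq: "core x (i + l) = core y (j + l)" if "\<bar>l\<bar> \<le> G" for l
  proof (rule core_local)
    fix t assume "- N \<le> t" "t < N + int m"
    then have "x (i + (l + t)) = y (j + (l + t))" using that by (intro e) linarith
    then show "x (i + l + t) = y (j + l + t)" by (simp add: add.assoc)
  qed
  have word_eq: "word x (i + l) m = word y (j + l) m" if "\<bar>l\<bar> \<le> G" for l
    unfolding word_eq_iff
  proof (intro allI impI)
    fix t assume "0 \<le> t \<and> t < int m"
    then have "x (i + (l + t)) = y (j + (l + t))" using that N_pos by (intro e) linarith
    then show "x (i + l + t) = y (j + l + t)" by (simp add: add.assoc)
  qed
  have core_eq': "core x (i - l) = core y (j - l)" and word_eq': "word x (i - l) m = word y (j - l) m"
    if "\<bar>l\<bar> \<le> G" for l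
    using core_eq[of "- l"] word_eq[of "- l"] that by simp_all
  have c0: "core x i = core y j" using core_eq[of 0] NG N_pos by simp
  have short: "in_short_gap x i s t = in_short_gap y j s t" for s t
  proof (cases "0 < s \<and> 0 < t \<and> s + t \<le> G")
    case True
    then have "(\<forall>l. - s < l \<and> l < t \<longrightarrow> \<not> core x (i + l)) = (\<forall>l. - s < l \<and> l < t \<longrightarrow> \<not> core y (j + l))"
      by (intro all_cong arg_cong[of _ _ Not] core_eq) linarith
    moreover have "core x (i - s) = core y (j - s)" "core x (i + t) = core y (j + t)"
      by (rule core_eq' core_eq, use True in linarith)+
    ultimately show ?thesis unfolding in_short_gap_def by (simp only:)
  qed (auto simp: in_short_gap_def)
  have right: "right_of_core x i s = right_of_core y j s" for s
  proof (cases "0 < s \<and> s \<le> N + int m")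
    case True
    then have "(\<forall>l. - s < l \<and> l \<le> 0 \<longrightarrow> \<not> core x (i + l)) = (\<forall>l. - s < l \<and> l \<le> 0 \<longrightarrow> \<not> core y (j + l))"
      using NG by (intro all_cong arg_cong[of _ _ Not] core_eq) linarith
    moreover have "core x (i - s) = core y (j - s)" by (rule core_eq') (use True NG in linarith)
    ultimately show ?thesis unfolding right_of_core_def by (simp only:)
  qed (auto simp: right_of_core_def)
  have left: "left_of_core x i t = left_of_core y j t" for t
  proof (cases "0 < t \<and> t \<le> N")
    case True
    then have "(\<forall>l. 0 \<le> l \<and> l < t \<longrightarrow> \<not> core x (i + l)) = (\<forall>l. 0 \<le> l \<and> l < t \<longrightarrow> \<not> core y (j + l))"
      using NG by (intro all_cong arg_cong[of _ _ Not] core_eq) linarith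
    moreover have "core x (i + t) = core y (j + t)" by (rule core_eq) (use True NG in linarith)
    ultimately show ?thesis unfolding left_of_core_def by (simp only:)
  qed (auto simp: left_of_core_def)
  show ?thesis
  proof (cases "\<exists>s t. in_short_gap x i s t")
    case True
    then obtain s t where st: "in_short_gap x i s t" by blast
    then have "in_short_gap y j s t" and le: "\<bar>s\<bar> \<le> G" "\<bar>t\<bar> \<le> G"
      using short by (auto simp: in_short_gap_def)
    then show ?thesis
      using repair_in_short_gap[OF st] repair_in_short_gap[of y j s t] word_eq'[OF le(1)] word_eq[OF le(2)] by simp
  next
    case no_short: False
    then have no_short': "\<not> (\<exists>s t. in_short_gap y j s t)" using short by simp
    show ?thesis
    proof (cases "\<exists>s. right_of_core x i s")
      case True
      then obtain s where s: "right_of_core x i s" by blast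
      then have s': "right_of_core y j s" and "\<bar>s\<bar> \<le> G"
        using right NG by (auto simp: right_of_core_def)
      then show ?thesis
        using repair_right_of_core[OF s no_short] repair_right_of_core[OF s' no_short'] word_eq' by simp
    next
      case no_right: False
      then have no_right': "\<not> (\<exists>s. right_of_core y j s)" using right by simp
      show ?thesis
      proof (cases "\<exists>t. left_of_core x i t")
        case True
        then obtain t where t: "left_of_core x i t" by blast
        then have t': "left_of_core y j t" and "\<bar>t\<bar> \<le> G"
          using left NG by (auto simp: left_of_core_def)
        then show ?thesis
          using repair_left_of_core[OF t no_short no_right] repair_left_of_core[OF t' no_short' no_right'] word_eq
          by simp
      next
        case no_left: False
        then have no_left': "\<not> (\<exists>t. left_of_core y j t)" using left by simp
        have "x i = y j" using e[of 0] NG N_pos by simp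
        then show ?thesis
          using repair_other[OF no_short no_right no_left] repair_other[OF no_short' no_right' no_left'] by simp
      qed
    qed
  qed
qed

lemma repair_cellular_automaton: "cellular_automaton A repair"
proof (rule CA_of_local[where r = "nat (G + N + int m)"])
  fix x y :: "'a config" and i j
  assume e: "\<And>t. \<bar>t\<bar> \<le> int (nat (G + N + int m)) \<Longrightarrow> x (i + t) = y (j + t)"
  show "repair x i = repair y j"
  proof (rule repair_local)
    fix t assume "\<bar>t\<bar> \<le> G + N + int m"
    then have "\<bar>t\<bar> \<le> int (nat (G + N + int m))" by linarith
    then show "x (i + t) = y (j + t)" by (rule e)
  qed
qed (rule repair_configs)

lemma repair_local_map: "local_map A repair (G + N + int m)"
proof (rule local_map.intro)
  show "finite A" by (rule finite_A)
  show "0 \<le> G + N + int m" using N_pos by (simp add: G_def)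
qed (rule repair_configs, assumption, rule repair_local)

end

sublocale gap_repair \<subseteq> local_map A repair "G + N + int m"
  by (rule repair_local_map)

context gap_repair begin

lemma core_of_X:
  assumes "y \<in> X" "\<And>t. - N \<le> t \<Longrightarrow> t < N + int m \<Longrightarrow> x (j + t) = y (j + t)"
  shows "core x j"
proof -
  have "core y j" unfolding core_def valid_def using word_in_windows[OF assms(1)] by blast
  moreover have "core x j = core y j" by (rule core_local) (rule assms(2))
  ultimately show ?thesis by simp
qed

text \<open>
  Configurations with a core beyond distance \<open>n\<close> on both sides; dense, because outside a given
  interval a configuration may be replaced by a point of \<open>X\<close>.
\<close>

definition surrounded :: "int \<Rightarrow> 'a config set" where
  "surrounded n = {x \<in> configs A. \<exists>a b. a \<le> - n \<and> n \<le> b \<and> core x a \<and> core x b}"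

lemma surrounded_open: "openin (config_top A) (surrounded n)"
  unfolding openin_config_top_iff
proof (intro conjI ballI)
  show "surrounded n \<subseteq> configs A" unfolding surrounded_def by (rule Collect_restrict)
  fix x assume "x \<in> surrounded n"
  then obtain a b where ab: "a \<le> - n" "n \<le> b" "core x a" "core x b" unfolding surrounded_def by blast
  define R where "R = \<bar>a\<bar> + \<bar>b\<bar> + N + int m"
  have "y \<in> surrounded n" if y: "y \<in> configs A" "\<forall>i. \<bar>i\<bar> \<le> R \<longrightarrow> y i = x i" for y
  proof -
    have "core y c = core x c" if "c = a \<or> c = b" for c
    proof (rule core_local)
      fix t assume "- N \<le> t" "t < N + int m"
      then have "\<bar>c + t\<bar> \<le> R" using that unfolding R_def by linarith
      then show "y (c + t) = x (c + t)" using y(2) by blast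
    qed
    then have "core y a" "core y b" using ab by simp_all
    then show ?thesis unfolding surrounded_def using ab y(1) by blast
  qed
  then show "\<exists>R. \<forall>y\<in>configs A. (\<forall>i. \<bar>i\<bar> \<le> R \<longrightarrow> y i = x i) \<longrightarrow> y \<in> surrounded n" by blast
qed

lemma surrounded_dense: "config_top A closure_of (surrounded n) = configs A"
proof (intro subset_antisym closure_of_subset_topspace subsetI)
  fix x assume x: "x \<in> configs A"
  obtain z where z: "z \<in> X" using nonempty by blast
  have "\<exists>y\<in>surrounded n \<inter> configs A. \<forall>i. \<bar>i\<bar> \<le> R \<longrightarrow> y i = x i" for R
  proof -
    define y where "y t = (if \<bar>t\<bar> \<le> R then x t else z t)" for t
    have y: "y \<in> configs A" using x X_letter[OF z] by (simp add: configs_iff y_def)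
    define b where "b = \<bar>R\<bar> + \<bar>n\<bar> + N + int m + 1"
    have "core y b" by (rule core_of_X[OF z]) (auto simp: y_def b_def)
    moreover have "core y (- b)" by (rule core_of_X[OF z]) (auto simp: y_def b_def)
    moreover have "- b \<le> - n" "n \<le> b" using N_pos by (auto simp: b_def)
    ultimately have "y \<in> surrounded n" unfolding surrounded_def using y by blast
    moreover have "\<forall>i. \<bar>i\<bar> \<le> R \<longrightarrow> y i = x i" by (simp add: y_def)
    ultimately show ?thesis using y by blast
  qed
  then show "x \<in> config_top A closure_of (surrounded n)"
    unfolding in_closure_of_config_top using x by blast
qed

text \<open>
  Every position lies between two cores, hence becomes a core and remains one.  Limit points
  thus have only valid windows.
\<close>

lemma surrounded_converges:
  assumes "\<And>n. x \<in> surrounded n"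
  shows "omega_limit A repair x \<subseteq> X"
proof
  fix y assume y: "y \<in> omega_limit A repair x"
  have x: "x \<in> configs A" using assms[of 0] by (simp add: surrounded_def)
  have yA: "y \<in> configs A" and lim: "\<And>n R. \<exists>k\<ge>n. \<forall>i. \<bar>i\<bar> \<le> R \<longrightarrow> (repair ^^ k) x i = y i"
    using y omega_limit_iff[OF x] by blast+
  show "y \<in> X"
  proof (rule complete[OF yA])
    fix i
    obtain a b where ab: "a \<le> - \<bar>i\<bar>" "\<bar>i\<bar> \<le> b" "core x a" "core x b"
      using assms[of "\<bar>i\<bar>"] unfolding surrounded_def by blast
    then have "a \<le> b" by linarith
    then obtain n where n: "\<forall>k. a \<le> k \<and> k \<le> b \<longrightarrow> core ((repair ^^ n) x) k"
      using cores_fill_up ab by blast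
    have "a \<le> i \<and> i \<le> b" using ab by linarith
    then have cn: "core ((repair ^^ n) x) i" using n by blast
    obtain k where k: "k \<ge> n" "\<forall>t. \<bar>t\<bar> \<le> \<bar>i\<bar> + int m \<longrightarrow> (repair ^^ k) x t = y t" using lim by blast
    have "(repair ^^ k) x = (repair ^^ (k - n)) ((repair ^^ n) x)"
      using k(1) by (metis comp_apply funpow_add le_add_diff_inverse2)
    then have "core ((repair ^^ k) x) i" using core_persists_iterate[OF cn] by simp
    then have "word ((repair ^^ k) x) i m \<in> windows" by (rule core_window)
    moreover have "word ((repair ^^ k) x) i m = word y i m"
      unfolding word_eq_iff using k(2) by auto
    ultimately show "word y i m \<in> (\<lambda>y. word y 0 m) ` X" unfolding windows_def by simp
  qed
qed

lemma X_generic_attractor: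
  assumes "closedin (config_top A) X"
  shows "generic_attractor A repair X"
proof -
  have "comeager_in (config_top A) (\<Inter>n\<in>UNIV. surrounded n)"
    by (rule comeager_Inter) (auto intro!: comeager_dense_open surrounded_open surrounded_dense)
  moreover have "(\<Inter>n\<in>UNIV. surrounded n) \<subseteq> attraction_realm A repair X"
  proof
    fix x assume "x \<in> (\<Inter>n\<in>UNIV. surrounded n)"
    then have x: "\<And>n. x \<in> surrounded n" by blast
    then have "x \<in> configs A" using x[of 0] by (simp add: surrounded_def)
    then show "x \<in> attraction_realm A repair X"
      unfolding attraction_realm_def using surrounded_converges[OF x] by blast
  qed
  moreover have "attraction_realm A repair X \<subseteq> topspace (config_top A)"
    unfolding attraction_realm_def by (rule Collect_restrict)
  ultimately have "comeager_in (config_top A) (attraction_realm A repair X)" by (rule comeager_mono)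
  then show ?thesis unfolding generic_attractor_def using assms by blast
qed

text \<open>
  A word of \<open>X\<close> surrounded by a margin of \<open>N + m\<close> further symbols consists of cores and is never
  changed.  Some configuration of the cylinder of this longer word is attracted by \<open>K\<close>, so \<open>K\<close> meets the
  cylinder of the original word; as \<open>K\<close> is closed, it contains every point of \<open>X\<close>.
\<close>

lemma X_subset_attractor:
  assumes K: "generic_attractor A repair K"
  shows "X \<subseteq> K"
proof
  fix y assume y: "y \<in> X"
  have yA: "y \<in> configs A" using y sub_configs by blast
  have "\<exists>z\<in>K. \<forall>i. \<bar>i\<bar> \<le> R \<longrightarrow> z i = y i" for R
  proof -
    define U where "U = {x \<in> configs A. \<forall>i. \<bar>i\<bar> \<le> R + N + int m \<longrightarrow> x i = y i}"
    have "openin (config_top A) U"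
      unfolding U_def by (rule clopen_of_local(1)[where R = "R + N + int m"]) simp
    moreover have "U \<noteq> {}" unfolding U_def using yA by blast
    ultimately have "U \<inter> attraction_realm A repair K \<noteq> {}"
      using K unfolding generic_attractor_def by (intro comeager_meets_open[OF finite_A]) auto
    then obtain x where x: "x \<in> configs A" "\<forall>i. \<bar>i\<bar> \<le> R + N + int m \<longrightarrow> x i = y i"
      and xK: "omega_limit A repair x \<subseteq> K"
      unfolding U_def attraction_realm_def by blast
    have fixed: "(repair ^^ n) x i = y i" if i: "\<bar>i\<bar> \<le> R" for n i
    proof -
      have "core x i"
      proof (rule core_of_X[OF y])
        fix t assume "- N \<le> t" "t < N + int m"
        then have "\<bar>i + t\<bar> \<le> R + N + int m" using i by linarith
        then show "x (i + t) = y (i + t)" using x(2) by blast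
      qed
      then have "(repair ^^ n) x i = x i" using core_persists_iterate by blast
      moreover have "\<bar>i\<bar> \<le> R + N + int m" using i N_pos by linarith
      ultimately show ?thesis using x(2) by simp
    qed
    have "omega_limit A repair x \<inter> configs A \<noteq> {}"
      by (rule omega_limit_meets_closed[OF x(1)]) (use iterate_closed[OF x(1)] in auto)
    then obtain z where z: "z \<in> omega_limit A repair x" by blast
    then obtain n where "\<forall>i. \<bar>i\<bar> \<le> R \<longrightarrow> (repair ^^ n) x i = z i" using omega_limit_iff[OF x(1)] by blast
    then have "\<forall>i. \<bar>i\<bar> \<le> R \<longrightarrow> z i = y i" using fixed by simp
    then show ?thesis using z xK by blast
  qed
  moreover have "closedin (config_top A) K" using K by (simp add: generic_attractor_def)
  ultimately show "y \<in> K" using yA unfolding closedin_config_top_iff by blast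
qed

theorem generic_limit_repair:
  assumes "closedin (config_top A) X"
  shows "generic_limit_set A repair = X"
  unfolding generic_limit_set_def using X_generic_attractor[OF assms] X_subset_attractor by blast

end

theorem corollary7p14:
  fixes A :: "'a set" and X :: "(int \<Rightarrow> 'a) set"
  assumes "infinite (UNIV :: 'a set)"
    and "finite A"
    and "SFT A X" and "X \<noteq> {}" and "transitive_shift X"
  shows "(\<exists>B f. finite B \<and> A \<subseteq> B \<and> cellular_automaton B f \<and> X = generic_limit_set B f)
    \<longleftrightarrow> mixing_shift X"
proof -
  obtain m where window: "window_shift A X m" by (rule SFT_window[OF assms(3)])
  then interpret window_shift A X m .
  show ?thesis
  proof
    assume "\<exists>B f. finite B \<and> A \<subseteq> B \<and> cellular_automaton B f \<and> X = generic_limit_set B f"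
    then obtain B f where B: "finite B" and CA: "cellular_automaton B f" and X: "X = generic_limit_set B f"
      by blast
    from CA obtain r where "local_map B f r"
      by (rule CA_imp_local_map[OF B])
    then interpret generic_window_shift A B f r X m
      using window X assms(4,5) by (simp add: generic_window_shift_def generic_window_shift_axioms_def)
    show "mixing_shift X" by (rule generic_limit_mixing)
  next
    assume mixing: "mixing_shift X"
    obtain N where N: "int m \<le> N" "\<And>u v d. u \<in> windows \<Longrightarrow> v \<in> windows \<Longrightarrow> N \<le> d \<Longrightarrow> reach u d v"
      by (rule mixing_uniform_gap[OF assms(2) mixing]) (rule that)
    interpret gap_repair A X m N
      by unfold_locales (use N assms in blast)+
    have "closedin (config_top A) X" using assms(3) by (simp add: SFT_def subshift_def)
    then have "X = generic_limit_set A repair" using generic_limit_repair by simp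
    then show "\<exists>B f. finite B \<and> A \<subseteq> B \<and> cellular_automaton B f \<and> X = generic_limit_set B f"
      using assms(2) repair_cellular_automaton by blast
  qed
qed

end
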